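(* Let $H$ be a Hopf algebra over a field $k$ with multiplication $\mu$, comultiplication $\Delta$ and antipode $S$. Define the linear map $q:H\otimes H\to H$ by $q=\mu(1\otimes\mu)(S\otimes 1\otimes 1)(\tau\otimes 1)(1\otimes\Delta)$, that is, $q(x\otimes y)=S(y_{(1)})\,x\,y_{(2)}$. Then $q$ satisfies the self-distributive law $$q(q\otimes 1)=q(q\otimes q)(1\otimes\tau\otimes 1)(1\otimes 1\otimes\Delta):H\otimes H\otimes H\to H .$$
   Context: $\tau$ is the flip $\tau(u\otimes v)=v\otimes u$, $1$ inside composites denotes the identity map, and $\Delta(y)=y_{(1)}\otimes y_{(2)}$ is the Sweedler notation. *)

theory Defs
  imports "HOL-Algebra.Module" "HOL-Algebra.AbelCoset"
begin

section \<open>Linear maps and the tensor product over a field\<close>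

text \<open>Vector spaces are modules of HOL-Algebra over a field \<open>K\<close>. In the module records built
  below the components \<open>mult\<close> and \<open>one\<close> carry no information, except in the ground module.\<close>

definition linear_maps ::
  "('k, 'm) ring_scheme \<Rightarrow> ('k, 'v, 'p) module_scheme \<Rightarrow> ('k, 'w, 'q) module_scheme \<Rightarrow> ('v \<Rightarrow> 'w) set"
  where "linear_maps K V W =
    {f \<in> carrier V \<rightarrow> carrier W.
      (\<forall>x\<in>carrier V. \<forall>y\<in>carrier V. f (x \<oplus>\<^bsub>V\<^esub> y) = f x \<oplus>\<^bsub>W\<^esub> f y) \<and>
      (\<forall>c\<in>carrier K. \<forall>x\<in>carrier V. f (c \<odot>\<^bsub>V\<^esub> x) = c \<odot>\<^bsub>W\<^esub> f x)}"

definition ground_module :: "('k, 'm) ring_scheme \<Rightarrow> ('k, 'k) module"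
  where "ground_module K =
    \<lparr>carrier = carrier K, mult = mult K, one = \<one>\<^bsub>K\<^esub>, zero = \<zero>\<^bsub>K\<^esub>, add = add K, smult = mult K\<rparr>"

definition free_module :: "('k, 'm) ring_scheme \<Rightarrow> 'i set \<Rightarrow> ('k, 'i \<Rightarrow> 'k) module"
  where "free_module K I =
    \<lparr>carrier = {f. (\<forall>i. f i \<in> carrier K) \<and> (\<forall>i. i \<notin> I \<longrightarrow> f i = \<zero>\<^bsub>K\<^esub>) \<and> finite {i. f i \<noteq> \<zero>\<^bsub>K\<^esub>}},
     mult = undefined, one = undefined,
     zero = (\<lambda>i. \<zero>\<^bsub>K\<^esub>),
     add = (\<lambda>f g i. f i \<oplus>\<^bsub>K\<^esub> g i),
     smult = (\<lambda>c f i. c \<otimes>\<^bsub>K\<^esub> f i)\<rparr>"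

definition free_gen :: "('k, 'm) ring_scheme \<Rightarrow> 'i \<Rightarrow> 'i \<Rightarrow> 'k"
  where "free_gen K i = (\<lambda>j. if j = i then \<one>\<^bsub>K\<^esub> else \<zero>\<^bsub>K\<^esub>)"

definition submodule_span ::
  "('k, 'm) ring_scheme \<Rightarrow> ('k, 'v, 'p) module_scheme \<Rightarrow> 'v set \<Rightarrow> 'v set"
  where "submodule_span K V G = \<Inter>{N. submodule N K V \<and> G \<subseteq> N}"

definition quotient_module ::
  "('k, 'v, 'p) module_scheme \<Rightarrow> 'v set \<Rightarrow> ('k, 'v set) module"
  where "quotient_module V N =
    \<lparr>carrier = a_rcosets\<^bsub>V\<^esub> N,
     mult = undefined, one = undefined,
     zero = N,
     add = set_add V,
     smult = (\<lambda>c X. \<Union>x\<in>X. N +>\<^bsub>V\<^esub> (c \<odot>\<^bsub>V\<^esub> x))\<rparr>"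

definition bilinear_relations ::
  "('k, 'm) ring_scheme \<Rightarrow> ('k, 'v, 'p) module_scheme \<Rightarrow> ('k, 'w, 'q) module_scheme
    \<Rightarrow> ('v \<times> 'w \<Rightarrow> 'k) set"
  where "bilinear_relations K V W =
    (let F = free_module K (carrier V \<times> carrier W); e = free_gen K in
      {e (v \<oplus>\<^bsub>V\<^esub> v', w) \<ominus>\<^bsub>F\<^esub> (e (v, w) \<oplus>\<^bsub>F\<^esub> e (v', w)) | v v' w.
         v \<in> carrier V \<and> v' \<in> carrier V \<and> w \<in> carrier W} \<union>
      {e (v, w \<oplus>\<^bsub>W\<^esub> w') \<ominus>\<^bsub>F\<^esub> (e (v, w) \<oplus>\<^bsub>F\<^esub> e (v, w')) | v w w'.
         v \<in> carrier V \<and> w \<in> carrier W \<and> w' \<in> carrier W} \<union>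
      {e (c \<odot>\<^bsub>V\<^esub> v, w) \<ominus>\<^bsub>F\<^esub> (c \<odot>\<^bsub>F\<^esub> e (v, w)) | c v w.
         c \<in> carrier K \<and> v \<in> carrier V \<and> w \<in> carrier W} \<union>
      {e (v, c \<odot>\<^bsub>W\<^esub> w) \<ominus>\<^bsub>F\<^esub> (c \<odot>\<^bsub>F\<^esub> e (v, w)) | c v w.
         c \<in> carrier K \<and> v \<in> carrier V \<and> w \<in> carrier W})"

definition tensor_kernel ::
  "('k, 'm) ring_scheme \<Rightarrow> ('k, 'v, 'p) module_scheme \<Rightarrow> ('k, 'w, 'q) module_scheme
    \<Rightarrow> ('v \<times> 'w \<Rightarrow> 'k) set"
  where "tensor_kernel K V W =
    submodule_span K (free_module K (carrier V \<times> carrier W)) (bilinear_relations K V W)"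

definition tensor_product ::
  "('k, 'm) ring_scheme \<Rightarrow> ('k, 'v, 'p) module_scheme \<Rightarrow> ('k, 'w, 'q) module_scheme
    \<Rightarrow> ('k, ('v \<times> 'w \<Rightarrow> 'k) set) module"
  where "tensor_product K V W =
    quotient_module (free_module K (carrier V \<times> carrier W)) (tensor_kernel K V W)"

definition pure_tensor ::
  "('k, 'm) ring_scheme \<Rightarrow> ('k, 'v, 'p) module_scheme \<Rightarrow> ('k, 'w, 'q) module_scheme
    \<Rightarrow> 'v \<Rightarrow> 'w \<Rightarrow> ('v \<times> 'w \<Rightarrow> 'k) set"
  where "pure_tensor K V W v w =
    tensor_kernel K V W +>\<^bsub>free_module K (carrier V \<times> carrier W)\<^esub> free_gen K (v, w)"

text \<open>The linear map \<open>V \<otimes> W \<rightarrow> U\<close> that the universal property assigns to a map \<open>b\<close> which is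
  bilinear on \<open>carrier V \<times> carrier W\<close>. Extensionality makes it unique as a HOL function; nothing
  is claimed when \<open>b\<close> is not bilinear.\<close>

definition tensor_lift ::
  "('k, 'm) ring_scheme \<Rightarrow> ('k, 'v, 'p) module_scheme \<Rightarrow> ('k, 'w, 'q) module_scheme
    \<Rightarrow> ('k, 'u, 'r) module_scheme \<Rightarrow> ('v \<Rightarrow> 'w \<Rightarrow> 'u) \<Rightarrow> ('v \<times> 'w \<Rightarrow> 'k) set \<Rightarrow> 'u"
  where "tensor_lift K V W U b =
    (THE f. f \<in> linear_maps K (tensor_product K V W) U \<and>
            f \<in> extensional (carrier (tensor_product K V W)) \<and>
            (\<forall>v\<in>carrier V. \<forall>w\<in>carrier W. f (pure_tensor K V W v w) = b v w))"

text \<open>For \<open>f : V \<rightarrow> V'\<close> and \<open>g : W \<rightarrow> W'\<close>, the map \<open>f \<otimes> g : V \<otimes> W \<rightarrow> V' \<otimes> W'\<close> is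
  \<open>tensor_map K V W V' W' f g\<close>.\<close>

definition tensor_map ::
  "('k, 'm) ring_scheme \<Rightarrow> ('k, 'v, 'p) module_scheme \<Rightarrow> ('k, 'w, 'q) module_scheme
    \<Rightarrow> ('k, 'v', 'p') module_scheme \<Rightarrow> ('k, 'w', 'q') module_scheme
    \<Rightarrow> ('v \<Rightarrow> 'v') \<Rightarrow> ('w \<Rightarrow> 'w') \<Rightarrow> ('v \<times> 'w \<Rightarrow> 'k) set \<Rightarrow> ('v' \<times> 'w' \<Rightarrow> 'k) set"
  where "tensor_map K V W V' W' f g =
    tensor_lift K V W (tensor_product K V' W') (\<lambda>v w. pure_tensor K V' W' (f v) (g w))"

definition tensor_flip ::
  "('k, 'm) ring_scheme \<Rightarrow> ('k, 'v, 'p) module_scheme \<Rightarrow> ('k, 'w, 'q) module_scheme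
    \<Rightarrow> ('v \<times> 'w \<Rightarrow> 'k) set \<Rightarrow> ('w \<times> 'v \<Rightarrow> 'k) set"
  where "tensor_flip K V W =
    tensor_lift K V W (tensor_product K W V) (\<lambda>v w. pure_tensor K W V w v)"

text \<open>The canonical isomorphism \<open>(U \<otimes> V) \<otimes> W \<rightarrow> U \<otimes> (V \<otimes> W)\<close> and its inverse, which are
  usually suppressed.\<close>

definition tensor_assoc ::
  "('k, 'm) ring_scheme \<Rightarrow> ('k, 'u, 'r) module_scheme \<Rightarrow> ('k, 'v, 'p) module_scheme
    \<Rightarrow> ('k, 'w, 'q) module_scheme
    \<Rightarrow> (('u \<times> 'v \<Rightarrow> 'k) set \<times> 'w \<Rightarrow> 'k) set \<Rightarrow> ('u \<times> ('v \<times> 'w \<Rightarrow> 'k) set \<Rightarrow> 'k) set"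
  where "tensor_assoc K U V W =
    (let VW = tensor_product K V W; T = tensor_product K U VW in
      tensor_lift K (tensor_product K U V) W T
        (\<lambda>t w. tensor_lift K U V T (\<lambda>u v. pure_tensor K U VW u (pure_tensor K V W v w)) t))"

definition tensor_assoc_inv ::
  "('k, 'm) ring_scheme \<Rightarrow> ('k, 'u, 'r) module_scheme \<Rightarrow> ('k, 'v, 'p) module_scheme
    \<Rightarrow> ('k, 'w, 'q) module_scheme
    \<Rightarrow> ('u \<times> ('v \<times> 'w \<Rightarrow> 'k) set \<Rightarrow> 'k) set \<Rightarrow> (('u \<times> 'v \<Rightarrow> 'k) set \<times> 'w \<Rightarrow> 'k) set"
  where "tensor_assoc_inv K U V W =
    (let UV = tensor_product K U V; T = tensor_product K UV W in
      tensor_lift K U (tensor_product K V W) T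
        (\<lambda>u t. tensor_lift K V W T (\<lambda>v w. pure_tensor K UV W (pure_tensor K U V u v) w) t))"

text \<open>\<open>1 \<otimes> \<tau> \<otimes> 1\<close> on the fourfold tensor power of \<open>V\<close>, bracketed as
  \<open>(V \<otimes> V) \<otimes> (V \<otimes> V)\<close>.\<close>

definition middle_flip ::
  "('k, 'm) ring_scheme \<Rightarrow> ('k, 'v, 'p) module_scheme
    \<Rightarrow> (('v \<times> 'v \<Rightarrow> 'k) set \<times> ('v \<times> 'v \<Rightarrow> 'k) set \<Rightarrow> 'k) set
    \<Rightarrow> (('v \<times> 'v \<Rightarrow> 'k) set \<times> ('v \<times> 'v \<Rightarrow> 'k) set \<Rightarrow> 'k) set"
  where "middle_flip K V =
    (let VV = tensor_product K V V; V_VV = tensor_product K V VV in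
      tensor_assoc_inv K V V VV \<circ>
      tensor_map K V V_VV V V_VV id
        (tensor_assoc K V V V \<circ>
         tensor_map K VV V VV V (tensor_flip K V V) id \<circ>
         tensor_assoc_inv K V V V) \<circ>
      tensor_assoc K V V VV)"


section \<open>Hopf algebras\<close>

text \<open>The locale \<open>algebra\<close> of HOL-Algebra requires a commutative multiplication and so cannot
  be used here.\<close>

locale field_algebra = field K + module K H + ring H
  for K :: "('k, 'm) ring_scheme" (structure) and H :: "('k, 'h, 'p) module_scheme" (structure) +
  assumes smult_mult_left:
      "\<lbrakk>c \<in> carrier K; x \<in> carrier H; y \<in> carrier H\<rbrakk> \<Longrightarrow>
        (c \<odot>\<^bsub>H\<^esub> x) \<otimes>\<^bsub>H\<^esub> y = c \<odot>\<^bsub>H\<^esub> (x \<otimes>\<^bsub>H\<^esub> y)"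
    and smult_mult_right:
      "\<lbrakk>c \<in> carrier K; x \<in> carrier H; y \<in> carrier H\<rbrakk> \<Longrightarrow>
        x \<otimes>\<^bsub>H\<^esub> (c \<odot>\<^bsub>H\<^esub> y) = c \<odot>\<^bsub>H\<^esub> (x \<otimes>\<^bsub>H\<^esub> y)"

definition mult_map ::
  "('k, 'm) ring_scheme \<Rightarrow> ('k, 'h, 'p) module_scheme \<Rightarrow> ('h \<times> 'h \<Rightarrow> 'k) set \<Rightarrow> 'h"
  where "mult_map K H = tensor_lift K H H H (mult H)"

locale hopf_algebra = field_algebra K H
  for K :: "('k, 'm) ring_scheme" (structure) and H :: "('k, 'h, 'p) module_scheme" (structure) +
  fixes \<Delta> :: "'h \<Rightarrow> ('h \<times> 'h \<Rightarrow> 'k) set"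
    and \<epsilon> :: "'h \<Rightarrow> 'k"
    and S :: "'h \<Rightarrow> 'h"
  assumes comult_linear: "\<Delta> \<in> linear_maps K H (tensor_product K H H)"
    and counit_linear: "\<epsilon> \<in> linear_maps K H (ground_module K)"
    and antipode_linear: "S \<in> linear_maps K H H"
    and coassoc:
      "x \<in> carrier H \<Longrightarrow>
        tensor_assoc K H H H (tensor_map K H H (tensor_product K H H) H \<Delta> id (\<Delta> x)) =
        tensor_map K H H H (tensor_product K H H) id \<Delta> (\<Delta> x)"
    and counit_left:
      "x \<in> carrier H \<Longrightarrow>
        tensor_lift K (ground_module K) H H (smult H)
          (tensor_map K H H (ground_module K) H \<epsilon> id (\<Delta> x)) = x"
    and counit_right:
      "x \<in> carrier H \<Longrightarrow>
        tensor_lift K H (ground_module K) H (\<lambda>y c. c \<odot>\<^bsub>H\<^esub> y)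
          (tensor_map K H H H (ground_module K) id \<epsilon> (\<Delta> x)) = x"
    and comult_mult:
      "\<lbrakk>x \<in> carrier H; y \<in> carrier H\<rbrakk> \<Longrightarrow>
        \<Delta> (x \<otimes>\<^bsub>H\<^esub> y) =
        tensor_map K (tensor_product K H H) (tensor_product K H H) H H (mult_map K H) (mult_map K H)
          (middle_flip K H
            (pure_tensor K (tensor_product K H H) (tensor_product K H H) (\<Delta> x) (\<Delta> y)))"
    and comult_one: "\<Delta> \<one>\<^bsub>H\<^esub> = pure_tensor K H H \<one>\<^bsub>H\<^esub> \<one>\<^bsub>H\<^esub>"
    and counit_mult:
      "\<lbrakk>x \<in> carrier H; y \<in> carrier H\<rbrakk> \<Longrightarrow> \<epsilon> (x \<otimes>\<^bsub>H\<^esub> y) = \<epsilon> x \<otimes>\<^bsub>K\<^esub> \<epsilon> y"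
    and counit_one: "\<epsilon> \<one>\<^bsub>H\<^esub> = \<one>\<^bsub>K\<^esub>"
    and antipode_left:
      "x \<in> carrier H \<Longrightarrow> mult_map K H (tensor_map K H H H H S id (\<Delta> x)) = \<epsilon> x \<odot>\<^bsub>H\<^esub> \<one>\<^bsub>H\<^esub>"
    and antipode_right:
      "x \<in> carrier H \<Longrightarrow> mult_map K H (tensor_map K H H H H id S (\<Delta> x)) = \<epsilon> x \<odot>\<^bsub>H\<^esub> \<one>\<^bsub>H\<^esub>"

text \<open>\<open>q = \<mu>(1 \<otimes> \<mu>)(S \<otimes> 1 \<otimes> 1)(\<tau> \<otimes> 1)(1 \<otimes> \<Delta>)\<close>, that is, \<open>x \<otimes> y \<mapsto> S(y\<^sub>1) x y\<^sub>2\<close>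
  in Sweedler notation.\<close>

definition adjoint_map ::
  "('k, 'm) ring_scheme \<Rightarrow> ('k, 'h, 'p) module_scheme \<Rightarrow> ('h \<Rightarrow> ('h \<times> 'h \<Rightarrow> 'k) set)
    \<Rightarrow> ('h \<Rightarrow> 'h) \<Rightarrow> ('h \<times> 'h \<Rightarrow> 'k) set \<Rightarrow> 'h"
  where "adjoint_map K H \<Delta> S =
    (let HH = tensor_product K H H in
      mult_map K H \<circ>
      tensor_map K H HH H H id (mult_map K H) \<circ>
      tensor_map K H HH H HH S id \<circ>
      tensor_assoc K H H H \<circ>
      tensor_map K HH H HH H (tensor_flip K H H) id \<circ>
      tensor_assoc_inv K H H H \<circ>
      tensor_map K H H H HH id \<Delta>)"

end

theory Submission
  imports Defs
begin

text \<open>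
  Write \<open>x \<triangleleft> y = S(y\<^sub>1) x y\<^sub>2\<close> for \<open>q(x \<otimes> y)\<close>. On pure tensors the claim reads
  \<open>(x \<triangleleft> y) \<triangleleft> z = (x \<triangleleft> z\<^sub>1) \<triangleleft> (y \<triangleleft> z\<^sub>2)\<close>, and it holds for the same reason as in a group, where
  \<open>x \<triangleleft> y\<close> is conjugation. Two facts are needed. First, \<open>\<triangleleft>\<close> is a right action,
  \<open>x \<triangleleft> (y z) = (x \<triangleleft> y) \<triangleleft> z\<close> (lemma \<open>adj_mult\<close>); this uses that \<open>\<Delta>\<close> is multiplicative and that
  \<open>S\<close> reverses products. Second, \<open>z\<^sub>1 (y \<triangleleft> z\<^sub>2) = z\<^sub>1 S(z\<^sub>2) y z\<^sub>3 = y z\<close> (lemma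
  \<open>sweedler_mult_adj\<close>). Hence
  \<open>(x \<triangleleft> z\<^sub>1) \<triangleleft> (y \<triangleleft> z\<^sub>2) = x \<triangleleft> (z\<^sub>1 (y \<triangleleft> z\<^sub>2)) = x \<triangleleft> (y z) = (x \<triangleleft> y) \<triangleleft> z\<close>.

  That \<open>S(x y) = S(y) S(x)\<close> (lemma \<open>antipode_mult\<close>) follows from one cancellation rule,
  \<open>g(y\<^sub>1) y\<^sub>2 S(y\<^sub>3) = g(y)\<close> for linear \<open>g\<close>: it allows the equation
  \<open>S(x\<^sub>1 y\<^sub>1) x\<^sub>2 y\<^sub>2 = \<epsilon>(x) \<epsilon>(y) 1\<close> to be solved for \<open>S(x y)\<close>, first in \<open>y\<close> and then in \<open>x\<close>.

  To make these computations rigorous, the universal property of the tensor product is established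
  from its construction as a quotient of a free module. It turns \<open>f(x\<^sub>1, x\<^sub>2)\<close>, for bilinear \<open>f\<close>, into
  a well-defined element \<open>sweedler x f\<close>, the lift of \<open>f\<close> evaluated at \<open>\<Delta> x\<close>. The axioms
  of a Hopf algebra become rewriting rules for such expressions, and linear maps may be moved in and
  out of them; what remains at each step is to check multilinearity.
\<close>

section \<open>Linear maps\<close>

lemma linear_mapsI:
  assumes "\<And>x. x \<in> carrier V \<Longrightarrow> f x \<in> carrier W"
    and "\<And>x y. \<lbrakk>x \<in> carrier V; y \<in> carrier V\<rbrakk> \<Longrightarrow> f (x \<oplus>\<^bsub>V\<^esub> y) = f x \<oplus>\<^bsub>W\<^esub> f y"
    and "\<And>c x. \<lbrakk>c \<in> carrier K; x \<in> carrier V\<rbrakk> \<Longrightarrow> f (c \<odot>\<^bsub>V\<^esub> x) = c \<odot>\<^bsub>W\<^esub> f x"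
  shows "f \<in> linear_maps K V W"
  using assms by (simp add: linear_maps_def)

lemma linear_maps_closed:
  "\<lbrakk>f \<in> linear_maps K V W; x \<in> carrier V\<rbrakk> \<Longrightarrow> f x \<in> carrier W"
  by (auto simp: linear_maps_def)

lemma linear_maps_add:
  "\<lbrakk>f \<in> linear_maps K V W; x \<in> carrier V; y \<in> carrier V\<rbrakk> \<Longrightarrow> f (x \<oplus>\<^bsub>V\<^esub> y) = f x \<oplus>\<^bsub>W\<^esub> f y"
  by (auto simp: linear_maps_def)

lemma linear_maps_smult:
  "\<lbrakk>f \<in> linear_maps K V W; c \<in> carrier K; x \<in> carrier V\<rbrakk> \<Longrightarrow> f (c \<odot>\<^bsub>V\<^esub> x) = c \<odot>\<^bsub>W\<^esub> f x"
  by (auto simp: linear_maps_def)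

lemma linear_maps_zero:
  assumes "module K V" "module K W" "f \<in> linear_maps K V W"
  shows "f \<zero>\<^bsub>V\<^esub> = \<zero>\<^bsub>W\<^esub>"
proof -
  interpret V: module K V by fact
  interpret W: module K W by fact
  have "f (\<zero>\<^bsub>K\<^esub> \<odot>\<^bsub>V\<^esub> \<zero>\<^bsub>V\<^esub>) = \<zero>\<^bsub>K\<^esub> \<odot>\<^bsub>W\<^esub> f \<zero>\<^bsub>V\<^esub>"
    by (rule linear_maps_smult[OF assms(3)]) auto
  then show ?thesis
    using linear_maps_closed[OF assms(3), of "\<zero>\<^bsub>V\<^esub>"] by simp
qed

lemma linear_maps_minus:
  assumes "module K V" "module K W" "f \<in> linear_maps K V W" "x \<in> carrier V" "y \<in> carrier V"
  shows "f (x \<ominus>\<^bsub>V\<^esub> y) = f x \<ominus>\<^bsub>W\<^esub> f y"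
proof -
  interpret V: module K V by fact
  interpret W: module K W by fact
  have y: "f y \<in> carrier W" using assms linear_maps_closed by metis
  have "f (\<ominus>\<^bsub>V\<^esub> y) = f ((\<ominus>\<^bsub>K\<^esub> \<one>\<^bsub>K\<^esub>) \<odot>\<^bsub>V\<^esub> y)"
    using assms(5) by (simp add: V.smult_l_minus)
  also have "\<dots> = (\<ominus>\<^bsub>K\<^esub> \<one>\<^bsub>K\<^esub>) \<odot>\<^bsub>W\<^esub> f y"
    by (rule linear_maps_smult[OF assms(3)]) (use assms in auto)
  also have "\<dots> = \<ominus>\<^bsub>W\<^esub> f y"
    using y by (simp add: W.smult_l_minus)
  finally show ?thesis
    using assms linear_maps_add[OF assms(3), of x "\<ominus>\<^bsub>V\<^esub> y"]
    by (simp add: a_minus_def)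
qed

lemma linear_maps_comp:
  assumes "f \<in> linear_maps K V W" "g \<in> linear_maps K W U"
  shows "g \<circ> f \<in> linear_maps K V U"
  using assms by (auto simp: linear_maps_def Pi_iff)

lemma linear_maps_compose:
  assumes "g \<in> linear_maps K W U" "f \<in> linear_maps K V W"
  shows "(\<lambda>x. g (f x)) \<in> linear_maps K V U"
  using linear_maps_comp[OF assms(2,1)] by (simp add: comp_def)

lemma linear_maps_ident: "(\<lambda>x. x) \<in> linear_maps K V V"
  by (simp add: linear_maps_def)

lemma linear_maps_id: "id \<in> linear_maps K V V"
  by (simp add: linear_maps_def)

lemma linear_maps_pointwise_add:
  assumes "module K W" and f: "f \<in> linear_maps K V W" and g: "g \<in> linear_maps K V W"
  shows "(\<lambda>x. f x \<oplus>\<^bsub>W\<^esub> g x) \<in> linear_maps K V W"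
proof -
  interpret W: module K W by fact
  show ?thesis
    by (rule linear_mapsI)
      (simp_all add: linear_maps_closed[OF f] linear_maps_closed[OF g] linear_maps_add[OF f]
        linear_maps_add[OF g] linear_maps_smult[OF f] linear_maps_smult[OF g] W.a_ac W.smult_r_distr)
qed

lemma linear_maps_pointwise_smult:
  assumes "module K W" and f: "f \<in> linear_maps K V W" and c: "c \<in> carrier K"
  shows "(\<lambda>x. c \<odot>\<^bsub>W\<^esub> f x) \<in> linear_maps K V W"
proof -
  interpret W: module K W by fact
  show ?thesis
  proof (rule linear_mapsI)
    fix d x assume "d \<in> carrier K" "x \<in> carrier V"
    then show "c \<odot>\<^bsub>W\<^esub> f (d \<odot>\<^bsub>V\<^esub> x) = d \<odot>\<^bsub>W\<^esub> (c \<odot>\<^bsub>W\<^esub> f x)"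
      using c linear_maps_closed[OF f] W.R.m_comm[of c d]
      by (simp add: linear_maps_smult[OF f] flip: W.smult_assoc1)
  qed (use c in \<open>simp_all add: linear_maps_closed[OF f] linear_maps_add[OF f] W.smult_r_distr\<close>)
qed

lemma linear_maps_restrict:
  assumes "module K V" "f \<in> linear_maps K V W"
  shows "restrict f (carrier V) \<in> linear_maps K V W"
proof -
  interpret V: module K V by fact
  show ?thesis using assms(2) by (auto simp: linear_maps_def)
qed

text \<open>Two linear maps agree on everything generated by a set on which they agree. Taking one of
  them to be zero gives the kernel of the other.\<close>

lemma submodule_linear_equalizer:
  assumes V: "module K V" and W: "module K W"
    and f: "f \<in> linear_maps K V W" and g: "g \<in> linear_maps K V W"
  shows "submodule {x \<in> carrier V. f x = g x} K V"
proof -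
  interpret V: module K V by fact
  interpret W: module K W by fact
  have inv: "f (\<ominus>\<^bsub>V\<^esub> x) = g (\<ominus>\<^bsub>V\<^esub> x)" if "x \<in> carrier V" "f x = g x" for x
    using that linear_maps_minus[OF V W f, of "\<zero>\<^bsub>V\<^esub>" x] linear_maps_minus[OF V W g, of "\<zero>\<^bsub>V\<^esub>" x]
      linear_maps_zero[OF V W f] linear_maps_zero[OF V W g]
    by (simp add: a_minus_def)
  show ?thesis
    by (rule V.submoduleI)
      (auto simp: linear_maps_zero[OF V W f] linear_maps_zero[OF V W g] inv
        linear_maps_add[OF f] linear_maps_add[OF g] linear_maps_smult[OF f] linear_maps_smult[OF g])
qed

definition bilinear_maps ::
  "('k, 'm) ring_scheme \<Rightarrow> ('k, 'v, 'p) module_scheme \<Rightarrow> ('k, 'w, 'q) module_scheme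
    \<Rightarrow> ('k, 'u, 'r) module_scheme \<Rightarrow> ('v \<Rightarrow> 'w \<Rightarrow> 'u) set"
  where "bilinear_maps K V W U =
    {b. (\<forall>v\<in>carrier V. b v \<in> linear_maps K W U) \<and>
        (\<forall>w\<in>carrier W. (\<lambda>v. b v w) \<in> linear_maps K V U)}"

lemma bilinear_mapsI:
  assumes "\<And>v. v \<in> carrier V \<Longrightarrow> (\<lambda>w. b v w) \<in> linear_maps K W U"
    and "\<And>w. w \<in> carrier W \<Longrightarrow> (\<lambda>v. b v w) \<in> linear_maps K V U"
  shows "b \<in> bilinear_maps K V W U"
  using assms by (simp add: bilinear_maps_def)

lemma bilinear_maps_left:
  "\<lbrakk>b \<in> bilinear_maps K V W U; w \<in> carrier W\<rbrakk> \<Longrightarrow> (\<lambda>v. b v w) \<in> linear_maps K V U"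
  by (simp add: bilinear_maps_def)

lemma bilinear_maps_right:
  "\<lbrakk>b \<in> bilinear_maps K V W U; v \<in> carrier V\<rbrakk> \<Longrightarrow> (\<lambda>w. b v w) \<in> linear_maps K W U"
  by (simp add: bilinear_maps_def)

section \<open>Quotient modules\<close>

context
  fixes K :: "('k, 'm) ring_scheme" and V :: "('k, 'v, 'p) module_scheme" and N :: "'v set"
  assumes V: "module K V" and N: "submodule N K V"
begin

interpretation V: module K V by (fact V)
interpretation N: submodule N K V by (fact N)
interpretation N: abelian_subgroup N V
  by (rule abelian_subgroupI3) (simp_all add: additive_subgroup_def N.subgroup_axioms V.abelian_group_axioms)

lemma coset_eq_iff:
  assumes "x \<in> carrier V" "y \<in> carrier V"
  shows "N +>\<^bsub>V\<^esub> x = N +>\<^bsub>V\<^esub> y \<longleftrightarrow> x \<ominus>\<^bsub>V\<^esub> y \<in> N"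
proof
  assume "N +>\<^bsub>V\<^esub> x = N +>\<^bsub>V\<^esub> y"
  then have "x \<in> N +>\<^bsub>V\<^esub> y" using N.a_rcos_self[OF assms(1)] by simp
  then show "x \<ominus>\<^bsub>V\<^esub> y \<in> N"
    using N.a_rcos_module[OF assms(2,1)] by (simp add: a_minus_def)
next
  assume "x \<ominus>\<^bsub>V\<^esub> y \<in> N"
  then have "x \<in> N +>\<^bsub>V\<^esub> y"
    using N.a_rcos_module[OF assms(2,1)] by (simp add: a_minus_def)
  then show "N +>\<^bsub>V\<^esub> x = N +>\<^bsub>V\<^esub> y"
    using N.a_repr_independence'[OF _ assms(2)] by simp
qed

lemma quotient_carrier: "carrier (quotient_module V N) = (\<lambda>x. N +>\<^bsub>V\<^esub> x) ` carrier V"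
  by (auto simp: quotient_module_def A_RCOSETS_def')

lemma quotient_add:
  "\<lbrakk>x \<in> carrier V; y \<in> carrier V\<rbrakk> \<Longrightarrow>
    (N +>\<^bsub>V\<^esub> x) \<oplus>\<^bsub>quotient_module V N\<^esub> (N +>\<^bsub>V\<^esub> y) = N +>\<^bsub>V\<^esub> (x \<oplus>\<^bsub>V\<^esub> y)"
  by (simp add: quotient_module_def N.a_rcos_sum)

text \<open>The scalar action is a union over the whole coset. All its members agree, because
  \<open>c n + c x\<close> and \<open>c x\<close> differ by \<open>c n\<close>, which lies in \<open>N\<close>.\<close>

lemma quotient_smult:
  assumes "c \<in> carrier K" "x \<in> carrier V"
  shows "c \<odot>\<^bsub>quotient_module V N\<^esub> (N +>\<^bsub>V\<^esub> x) = N +>\<^bsub>V\<^esub> (c \<odot>\<^bsub>V\<^esub> x)"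
proof -
  have "N +>\<^bsub>V\<^esub> (c \<odot>\<^bsub>V\<^esub> y) = N +>\<^bsub>V\<^esub> (c \<odot>\<^bsub>V\<^esub> x)" if y: "y \<in> N +>\<^bsub>V\<^esub> x" for y
  proof -
    obtain n where n: "n \<in> N" "y = n \<oplus>\<^bsub>V\<^esub> x"
      using y by (auto simp: a_r_coset_def')
    have "c \<odot>\<^bsub>V\<^esub> y = c \<odot>\<^bsub>V\<^esub> n \<oplus>\<^bsub>V\<^esub> c \<odot>\<^bsub>V\<^esub> x"
      using n assms by (simp add: V.smult_r_distr)
    then have "c \<odot>\<^bsub>V\<^esub> y \<in> N +>\<^bsub>V\<^esub> (c \<odot>\<^bsub>V\<^esub> x)"
      using n assms by (auto simp: a_r_coset_def')
    then show ?thesis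
      using V.a_repr_independence[OF _ _ N.subgroup_axioms] assms by simp
  qed
  then have "(\<Union>y\<in>N +>\<^bsub>V\<^esub> x. N +>\<^bsub>V\<^esub> (c \<odot>\<^bsub>V\<^esub> y)) = (\<Union>y\<in>N +>\<^bsub>V\<^esub> x. N +>\<^bsub>V\<^esub> (c \<odot>\<^bsub>V\<^esub> x))"
    by (intro SUP_cong refl)
  also have "\<dots> = N +>\<^bsub>V\<^esub> (c \<odot>\<^bsub>V\<^esub> x)"
    using N.a_rcos_self[OF assms(2)] by (intro UN_constant_eq) auto
  finally show ?thesis by (simp add: quotient_module_def)
qed

lemma quotient_zero: "\<zero>\<^bsub>quotient_module V N\<^esub> = N +>\<^bsub>V\<^esub> \<zero>\<^bsub>V\<^esub>"
  using N.a_subset by (simp add: quotient_module_def)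

lemma quotient_module_is_module: "module K (quotient_module V N)"
proof (rule moduleI)
  show "abelian_group (quotient_module V N)"
  proof (rule abelian_groupI)
    fix x assume "x \<in> carrier (quotient_module V N)"
    then obtain v where v: "v \<in> carrier V" "x = N +>\<^bsub>V\<^esub> v" by (auto simp: quotient_carrier)
    then show "\<exists>y\<in>carrier (quotient_module V N). y \<oplus>\<^bsub>quotient_module V N\<^esub> x = \<zero>\<^bsub>quotient_module V N\<^esub>"
      by (intro bexI[of _ "N +>\<^bsub>V\<^esub> (\<ominus>\<^bsub>V\<^esub> v)"]) (auto simp: quotient_carrier quotient_add quotient_zero V.l_neg)
  qed (auto simp: quotient_carrier quotient_add quotient_zero V.a_ac)
qed (auto simp: quotient_carrier quotient_add quotient_smult V.smult_l_distr V.smult_r_distr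
      V.smult_assoc1 V.R.cring_axioms)

lemma coset_linear: "(\<lambda>x. N +>\<^bsub>V\<^esub> x) \<in> linear_maps K V (quotient_module V N)"
  by (rule linear_mapsI) (auto simp: quotient_carrier quotient_add quotient_smult)

lemma quotient_induced_map:
  assumes W: "module K W" and f: "f \<in> linear_maps K V W" and "\<And>n. n \<in> N \<Longrightarrow> f n = \<zero>\<^bsub>W\<^esub>"
  shows "\<exists>g \<in> linear_maps K (quotient_module V N) W. \<forall>x\<in>carrier V. g (N +>\<^bsub>V\<^esub> x) = f x"
proof -
  interpret W: module K W by fact
  \<comment> \<open>Any representative of the coset may be used: two of them differ by an element of \<open>N\<close>, which \<open>f\<close> kills.\<close>
  define g where "g X = f (SOME x. x \<in> carrier V \<and> X = N +>\<^bsub>V\<^esub> x)" for X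
  have g: "g (N +>\<^bsub>V\<^esub> x) = f x" if x: "x \<in> carrier V" for x
  proof -
    define y where "y = (SOME y. y \<in> carrier V \<and> N +>\<^bsub>V\<^esub> x = N +>\<^bsub>V\<^esub> y)"
    have y: "y \<in> carrier V \<and> N +>\<^bsub>V\<^esub> x = N +>\<^bsub>V\<^esub> y"
      unfolding y_def by (rule someI[of _ x]) (use x in auto)
    then have "f x \<ominus>\<^bsub>W\<^esub> f y = \<zero>\<^bsub>W\<^esub>"
      using assms(3) coset_eq_iff[of x y] x linear_maps_minus[OF V W f, of x y] by metis
    then have "f x = f y"
      using x y linear_maps_closed[OF f] by (simp add: W.add.inv_solve_right' a_minus_def)
    then show ?thesis by (simp add: g_def y_def)
  qed
  have "g \<in> linear_maps K (quotient_module V N) W"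
    by (rule linear_mapsI)
      (auto simp: quotient_carrier quotient_add quotient_smult g linear_maps_closed[OF f]
        linear_maps_add[OF f] linear_maps_smult[OF f])
  then show ?thesis using g by blast
qed

end

section \<open>Free modules\<close>

lemma free_module_is_module:
  assumes "cring K"
  shows "module K (free_module K I)"
proof -
  interpret K: cring K by fact
  have fin: "finite {i. f i \<oplus>\<^bsub>K\<^esub> g i \<noteq> \<zero>\<^bsub>K\<^esub>}"
    if "finite {i. f i \<noteq> \<zero>\<^bsub>K\<^esub>}" "finite {i. g i \<noteq> \<zero>\<^bsub>K\<^esub>}" for f g :: "'c \<Rightarrow> 'a"
    by (rule finite_subset[of _ "{i. f i \<noteq> \<zero>\<^bsub>K\<^esub>} \<union> {i. g i \<noteq> \<zero>\<^bsub>K\<^esub>}"]) (use that in auto)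
  have fin': "finite {i. c \<otimes>\<^bsub>K\<^esub> f i \<noteq> \<zero>\<^bsub>K\<^esub>}"
    if "finite {i. f i \<noteq> \<zero>\<^bsub>K\<^esub>}" "c \<in> carrier K" for f :: "'c \<Rightarrow> 'a" and c
    by (rule finite_subset[of _ "{i. f i \<noteq> \<zero>\<^bsub>K\<^esub>}"]) (use that in auto)
  have fin_minus: "finite {i. \<ominus>\<^bsub>K\<^esub> f i \<noteq> \<zero>\<^bsub>K\<^esub>}"
    if "finite {i. f i \<noteq> \<zero>\<^bsub>K\<^esub>}" for f :: "'c \<Rightarrow> 'a"
    by (rule finite_subset[of _ "{i. f i \<noteq> \<zero>\<^bsub>K\<^esub>}"]) (use that in auto)
  show ?thesis
  proof (rule moduleI)
    show "abelian_group (free_module K I)"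
    proof (rule abelian_groupI)
      fix f assume f: "f \<in> carrier (free_module K I)"
      then have "(\<lambda>i. \<ominus>\<^bsub>K\<^esub> f i) \<in> carrier (free_module K I)"
        using fin_minus by (simp add: free_module_def)
      moreover have "(\<lambda>i. \<ominus>\<^bsub>K\<^esub> f i) \<oplus>\<^bsub>free_module K I\<^esub> f = \<zero>\<^bsub>free_module K I\<^esub>"
        using f by (simp add: free_module_def K.l_neg)
      ultimately show "\<exists>g\<in>carrier (free_module K I). g \<oplus>\<^bsub>free_module K I\<^esub> f = \<zero>\<^bsub>free_module K I\<^esub>"
        by blast
    qed (simp_all add: free_module_def fun_eq_iff K.a_ac fin)
  qed (simp_all add: free_module_def fun_eq_iff K.l_distr K.r_distr K.m_assoc K.cring_axioms fin')
qed

lemma free_gen_closed: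
  assumes "cring K" "i \<in> I"
  shows "free_gen K i \<in> carrier (free_module K I)"
proof -
  interpret K: cring K by fact
  show ?thesis using assms(2) by (auto simp: free_module_def free_gen_def)
qed

text \<open>Induction on a finite set containing the support: splitting off the value at one index leaves
  a function with smaller support.\<close>

lemma submodule_containing_free_gens:
  assumes "cring K" and N: "submodule N K (free_module K I)"
    and gen: "\<And>i. i \<in> I \<Longrightarrow> free_gen K i \<in> N" and f: "f \<in> carrier (free_module K I)"
  shows "f \<in> N"
proof -
  interpret K: cring K by fact
  interpret F: module K "free_module K I" by (rule free_module_is_module) fact
  interpret N: submodule N K "free_module K I" by fact
  have "f \<in> N" if "finite A" "f \<in> carrier (free_module K I)" "{i. f i \<noteq> \<zero>\<^bsub>K\<^esub>} \<subseteq> A" for A f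
    using that
  proof (induction A arbitrary: f rule: finite_induct)
    case empty
    then have "f = \<zero>\<^bsub>free_module K I\<^esub>" by (auto simp: free_module_def)
    then show ?case using N.one_closed by simp
  next
    case (insert a A)
    let ?g = "f(a := \<zero>\<^bsub>K\<^esub>)"
    have g: "?g \<in> N"
    proof (rule insert.IH)
      show "?g \<in> carrier (free_module K I)"
        using insert.prems(1) by (auto simp: free_module_def elim!: rev_finite_subset)
    qed (use insert.prems in auto)
    show ?case
    proof (cases "a \<in> I")
      case True
      have "f = ?g \<oplus>\<^bsub>free_module K I\<^esub> (f a \<odot>\<^bsub>free_module K I\<^esub> free_gen K a)"
        using insert.prems(1) by (auto simp: free_module_def free_gen_def fun_eq_iff)
      also have "\<dots> \<in> N"
        using F.submoduleE(5)[OF N g] F.submoduleE(4)[OF N _ gen[OF True]] insert.prems(1)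
        by (auto simp: free_module_def)
      finally show ?thesis .
    next
      case False
      then have "?g = f" using insert.prems(1) by (auto simp: free_module_def)
      then show ?thesis using g by simp
    qed
  qed
  then show ?thesis using f by (auto simp: free_module_def)
qed

text \<open>The extension is \<open>f \<mapsto> \<Sum> f(i) g(i)\<close>, summed over the support of \<open>f\<close>. The support varies with
  \<open>f\<close>, so additivity is checked on a common finite set containing both supports.\<close>

lemma free_module_extension:
  assumes "module K W" and g: "\<And>i. i \<in> I \<Longrightarrow> g i \<in> carrier W"
  shows "\<exists>f \<in> linear_maps K (free_module K I) W. \<forall>i\<in>I. f (free_gen K i) = g i"
proof -
  interpret W: module K W by fact
  define ev where "ev f = (\<Oplus>\<^bsub>W\<^esub>i\<in>{i. f i \<noteq> \<zero>\<^bsub>K\<^esub>}. f i \<odot>\<^bsub>W\<^esub> g i)" for f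
  have ev: "ev f = (\<Oplus>\<^bsub>W\<^esub>i\<in>A. f i \<odot>\<^bsub>W\<^esub> g i)"
    if "f \<in> carrier (free_module K I)" "finite A" "A \<subseteq> I" "{i. f i \<noteq> \<zero>\<^bsub>K\<^esub>} \<subseteq> A" for f A
    unfolding ev_def
    by (rule W.add.finprod_mono_neutral_cong_left) (use that g in \<open>auto simp: free_module_def Pi_iff\<close>)
  have supp: "finite {i. f i \<noteq> \<zero>\<^bsub>K\<^esub>}" "{i. f i \<noteq> \<zero>\<^bsub>K\<^esub>} \<subseteq> I" "\<And>i. f i \<in> carrier K"
    if "f \<in> carrier (free_module K I)" for f
    using that by (auto simp: free_module_def)
  interpret F: module K "free_module K I" by (rule free_module_is_module) (rule W.R.cring_axioms)
  have "ev \<in> linear_maps K (free_module K I) W"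
  proof (rule linear_mapsI)
    fix f h assume f: "f \<in> carrier (free_module K I)" and h: "h \<in> carrier (free_module K I)"
    let ?A = "{i. f i \<noteq> \<zero>\<^bsub>K\<^esub>} \<union> {i. h i \<noteq> \<zero>\<^bsub>K\<^esub>}"
    have A: "finite ?A" "?A \<subseteq> I" using supp[OF f] supp[OF h] by auto
    have gA: "g i \<in> carrier W" if "i \<in> ?A" for i using A(2) g that by blast
    have "ev (f \<oplus>\<^bsub>free_module K I\<^esub> h) = (\<Oplus>\<^bsub>W\<^esub>i\<in>?A. (f i \<oplus>\<^bsub>K\<^esub> h i) \<odot>\<^bsub>W\<^esub> g i)"
      using A by (subst ev[OF F.a_closed[OF f h], of ?A]) (auto simp: free_module_def)
    also have "\<dots> = (\<Oplus>\<^bsub>W\<^esub>i\<in>?A. f i \<odot>\<^bsub>W\<^esub> g i \<oplus>\<^bsub>W\<^esub> h i \<odot>\<^bsub>W\<^esub> g i)"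
      using gA supp(3)[OF f] supp(3)[OF h]
      by (intro W.add.finprod_cong') (auto simp: W.smult_l_distr)
    also have "\<dots> = (\<Oplus>\<^bsub>W\<^esub>i\<in>?A. f i \<odot>\<^bsub>W\<^esub> g i) \<oplus>\<^bsub>W\<^esub> (\<Oplus>\<^bsub>W\<^esub>i\<in>?A. h i \<odot>\<^bsub>W\<^esub> g i)"
      using gA supp(3)[OF f] supp(3)[OF h] by (intro W.finsum_addf) auto
    also have "\<dots> = ev f \<oplus>\<^bsub>W\<^esub> ev h"
      using A by (subst (1 2) ev[of _ ?A]) (use f h in auto)
    finally show "ev (f \<oplus>\<^bsub>free_module K I\<^esub> h) = ev f \<oplus>\<^bsub>W\<^esub> ev h" .
  next
    fix c f assume c: "c \<in> carrier K" and f: "f \<in> carrier (free_module K I)"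
    let ?A = "{i. f i \<noteq> \<zero>\<^bsub>K\<^esub>}"
    have gA: "g i \<in> carrier W" if "i \<in> ?A" for i using supp(2)[OF f] g that by blast
    have "ev (c \<odot>\<^bsub>free_module K I\<^esub> f) = (\<Oplus>\<^bsub>W\<^esub>i\<in>?A. (c \<otimes>\<^bsub>K\<^esub> f i) \<odot>\<^bsub>W\<^esub> g i)"
      using supp[OF f] c by (subst ev[OF F.smult_closed[OF c f], of ?A]) (auto simp: free_module_def)
    also have "\<dots> = (\<Oplus>\<^bsub>W\<^esub>i\<in>?A. c \<odot>\<^bsub>W\<^esub> (f i \<odot>\<^bsub>W\<^esub> g i))"
      using gA supp(3)[OF f] c by (intro W.add.finprod_cong') (auto simp: W.smult_assoc1)
    also have "\<dots> = c \<odot>\<^bsub>W\<^esub> ev f"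
      unfolding ev_def using gA supp[OF f] c by (intro W.finsum_smult_ldistr[symmetric]) auto
    finally show "ev (c \<odot>\<^bsub>free_module K I\<^esub> f) = c \<odot>\<^bsub>W\<^esub> ev f" .
  next
    fix f assume f: "f \<in> carrier (free_module K I)"
    show "ev f \<in> carrier W"
      unfolding ev_def using supp[OF f] g by (intro W.finsum_closed) auto
  qed
  moreover have "ev (free_gen K i) = g i" if i: "i \<in> I" for i
  proof -
    have "ev (free_gen K i) = (\<Oplus>\<^bsub>W\<^esub>j\<in>{i}. free_gen K i j \<odot>\<^bsub>W\<^esub> g j)"
      by (rule ev[OF free_gen_closed[OF W.R.cring_axioms i]]) (use i in \<open>auto simp: free_gen_def\<close>)
    also have "\<dots> = g i" using g[OF i] by (simp add: free_gen_def)
    finally show ?thesis .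
  qed
  ultimately show ?thesis by blast
qed

section \<open>The universal property of the tensor product\<close>

lemma submodule_span_least: "\<lbrakk>submodule N K V; G \<subseteq> N\<rbrakk> \<Longrightarrow> submodule_span K V G \<subseteq> N"
  by (auto simp: submodule_span_def)

lemma submodule_span_superset: "G \<subseteq> submodule_span K V G"
  by (auto simp: submodule_span_def)

lemma submodule_span_is_submodule:
  assumes "module K V" "G \<subseteq> carrier V"
  shows "submodule (submodule_span K V G) K V"
proof -
  interpret V: module K V by fact
  have "submodule (carrier V) K V" by (rule V.carrier_is_submodule)
  then have "submodule_span K V G \<subseteq> carrier V"
    using assms(2) by (rule submodule_span_least)
  then show ?thesis
    by (rule V.submoduleI)
      (auto simp: submodule_span_def subgroup.one_closed[OF submodule.axioms(1), simplified]
        intro: V.submoduleE)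
qed

context
  fixes K :: "('k, 'm) ring_scheme" and V :: "('k, 'v, 'p) module_scheme"
    and W :: "('k, 'w, 'q) module_scheme"
  assumes V: "module K V" and W: "module K W"
begin

interpretation V: module K V by (fact V)
interpretation W: module K W by (fact W)

private abbreviation (input) "free_VW \<equiv> free_module K (carrier V \<times> carrier W)"

interpretation F: module K free_VW
  by (rule free_module_is_module) (rule V.R.cring_axioms)

lemma free_gen_VW_closed:
  "\<lbrakk>v \<in> carrier V; w \<in> carrier W\<rbrakk> \<Longrightarrow> free_gen K (v, w) \<in> carrier free_VW"
  by (rule free_gen_closed) (auto intro: V.R.cring_axioms)

lemma tensor_kernel_submodule: "submodule (tensor_kernel K V W) K free_VW"
  unfolding tensor_kernel_def
  by (rule submodule_span_is_submodule[OF F.module_axioms])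
    (auto simp: bilinear_relations_def Let_def intro!: F.minus_closed F.a_closed F.smult_closed free_gen_VW_closed)

lemma bilinear_relations_in_kernel: "bilinear_relations K V W \<subseteq> tensor_kernel K V W"
  unfolding tensor_kernel_def by (rule submodule_span_superset)

lemma tensor_product_is_module: "module K (tensor_product K V W)"
  unfolding tensor_product_def
  by (rule quotient_module_is_module[OF F.module_axioms tensor_kernel_submodule])

lemma tensor_coset_linear:
  "(\<lambda>f. tensor_kernel K V W +>\<^bsub>free_VW\<^esub> f) \<in> linear_maps K free_VW (tensor_product K V W)"
  unfolding tensor_product_def
  by (rule coset_linear[OF F.module_axioms tensor_kernel_submodule])

lemma tensor_coset_eqI:
  assumes "f \<ominus>\<^bsub>free_VW\<^esub> g \<in> bilinear_relations K V W" "f \<in> carrier free_VW" "g \<in> carrier free_VW"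
  shows "tensor_kernel K V W +>\<^bsub>free_VW\<^esub> f = tensor_kernel K V W +>\<^bsub>free_VW\<^esub> g"
  using coset_eq_iff[OF F.module_axioms tensor_kernel_submodule assms(2,3)]
    bilinear_relations_in_kernel assms(1) by blast

text \<open>Each of the four families of relations was put into the kernel to give one of the four
  identities of bilinearity.\<close>

lemma pure_tensor_bilinear: "pure_tensor K V W \<in> bilinear_maps K V W (tensor_product K V W)"
proof -
  let ?e = "\<lambda>v w. free_gen K (v, w)"
  let ?p = "\<lambda>f. tensor_kernel K V W +>\<^bsub>free_VW\<^esub> f"
  note cl = free_gen_VW_closed F.a_closed F.smult_closed V.a_closed W.a_closed V.smult_closed W.smult_closed
  note eqs = linear_maps_add[OF tensor_coset_linear] linear_maps_smult[OF tensor_coset_linear]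
  have closed: "pure_tensor K V W v w \<in> carrier (tensor_product K V W)"
    if "v \<in> carrier V" "w \<in> carrier W" for v w
    unfolding pure_tensor_def using that by (intro linear_maps_closed[OF tensor_coset_linear] cl)
  show ?thesis
  proof (intro bilinear_mapsI linear_mapsI closed)
    fix v w w' assume A: "v \<in> carrier V" "w \<in> carrier W" "w' \<in> carrier W"
    have "?p (?e v (w \<oplus>\<^bsub>W\<^esub> w')) = ?p (?e v w \<oplus>\<^bsub>free_VW\<^esub> ?e v w')"
      by (intro tensor_coset_eqI cl A) (use A in \<open>unfold bilinear_relations_def Let_def, blast\<close>)
    then show "pure_tensor K V W v (w \<oplus>\<^bsub>W\<^esub> w') = pure_tensor K V W v w \<oplus>\<^bsub>tensor_product K V W\<^esub> pure_tensor K V W v w'"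
      using A by (simp add: pure_tensor_def eqs cl)
  next
    fix v c w assume A: "v \<in> carrier V" "c \<in> carrier K" "w \<in> carrier W"
    have "?p (?e v (c \<odot>\<^bsub>W\<^esub> w)) = ?p (c \<odot>\<^bsub>free_VW\<^esub> ?e v w)"
      by (intro tensor_coset_eqI cl A) (use A in \<open>unfold bilinear_relations_def Let_def, blast\<close>)
    then show "pure_tensor K V W v (c \<odot>\<^bsub>W\<^esub> w) = c \<odot>\<^bsub>tensor_product K V W\<^esub> pure_tensor K V W v w"
      using A by (simp add: pure_tensor_def eqs cl)
  next
    fix w v v' assume A: "w \<in> carrier W" "v \<in> carrier V" "v' \<in> carrier V"
    have "?p (?e (v \<oplus>\<^bsub>V\<^esub> v') w) = ?p (?e v w \<oplus>\<^bsub>free_VW\<^esub> ?e v' w)"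
      by (intro tensor_coset_eqI cl A) (use A in \<open>unfold bilinear_relations_def Let_def, blast\<close>)
    then show "pure_tensor K V W (v \<oplus>\<^bsub>V\<^esub> v') w = pure_tensor K V W v w \<oplus>\<^bsub>tensor_product K V W\<^esub> pure_tensor K V W v' w"
      using A by (simp add: pure_tensor_def eqs cl)
  next
    fix w c v assume A: "w \<in> carrier W" "c \<in> carrier K" "v \<in> carrier V"
    have "?p (?e (c \<odot>\<^bsub>V\<^esub> v) w) = ?p (c \<odot>\<^bsub>free_VW\<^esub> ?e v w)"
      by (intro tensor_coset_eqI cl A) (use A in \<open>unfold bilinear_relations_def Let_def, blast\<close>)
    then show "pure_tensor K V W (c \<odot>\<^bsub>V\<^esub> v) w = c \<odot>\<^bsub>tensor_product K V W\<^esub> pure_tensor K V W v w"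
      using A by (simp add: pure_tensor_def eqs cl)
  qed
qed

lemma pure_tensor_closed:
  "\<lbrakk>v \<in> carrier V; w \<in> carrier W\<rbrakk> \<Longrightarrow> pure_tensor K V W v w \<in> carrier (tensor_product K V W)"
  by (rule linear_maps_closed[OF bilinear_maps_right[OF pure_tensor_bilinear]])

text \<open>The uniqueness half of the universal property: the cosets of the free generators are the pure
  tensors, so the equalizer pulled back to the free module contains all generators.\<close>

lemma tensor_product_ext:
  assumes U: "module K U" and f: "f \<in> linear_maps K (tensor_product K V W) U"
    and g: "g \<in> linear_maps K (tensor_product K V W) U"
    and eq: "\<And>v w. \<lbrakk>v \<in> carrier V; w \<in> carrier W\<rbrakk> \<Longrightarrow> f (pure_tensor K V W v w) = g (pure_tensor K V W v w)"
    and t: "t \<in> carrier (tensor_product K V W)"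
  shows "f t = g t"
proof -
  let ?p = "\<lambda>f. tensor_kernel K V W +>\<^bsub>free_VW\<^esub> f"
  obtain x where x: "x \<in> carrier free_VW" "t = ?p x"
    using t quotient_carrier[OF F.module_axioms tensor_kernel_submodule] by (auto simp: tensor_product_def)
  have sub: "submodule {x \<in> carrier free_VW. f (?p x) = g (?p x)} K free_VW"
    by (rule submodule_linear_equalizer[OF F.module_axioms U linear_maps_compose[OF f tensor_coset_linear]
        linear_maps_compose[OF g tensor_coset_linear]])
  have "x \<in> {x \<in> carrier free_VW. f (?p x) = g (?p x)}"
  proof (rule submodule_containing_free_gens[OF V.R.cring_axioms sub _ x(1)])
    fix i assume "i \<in> carrier V \<times> carrier W"
    then obtain v w where "i = (v, w)" "v \<in> carrier V" "w \<in> carrier W" by auto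
    then show "free_gen K i \<in> {x \<in> carrier free_VW. f (?p x) = g (?p x)}"
      using eq by (simp add: free_gen_VW_closed flip: pure_tensor_def)
  qed
  then show ?thesis using x by simp
qed

text \<open>The existence half: a bilinear map extends linearly to the free module, and bilinearity says
  precisely that this extension kills the relations, hence the submodule spanned by them.\<close>

lemma tensor_product_universal:
  assumes U: "module K U" and b: "b \<in> bilinear_maps K V W U"
  shows "\<exists>f \<in> linear_maps K (tensor_product K V W) U.
    \<forall>v\<in>carrier V. \<forall>w\<in>carrier W. f (pure_tensor K V W v w) = b v w"
proof -
  interpret U: module K U by fact
  note bl = bilinear_maps_left[OF b] and br = bilinear_maps_right[OF b]
  have bc: "b v w \<in> carrier U" if "v \<in> carrier V" "w \<in> carrier W" for v w
    using linear_maps_closed[OF br] that by blast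
  obtain g where g: "g \<in> linear_maps K free_VW U"
    and gg: "\<And>v w. \<lbrakk>v \<in> carrier V; w \<in> carrier W\<rbrakk> \<Longrightarrow> g (free_gen K (v, w)) = b v w"
    using free_module_extension[OF U, of "carrier V \<times> carrier W" "\<lambda>(v, w). b v w"] bc by fastforce
  note gs = linear_maps_minus[OF F.module_axioms U g] linear_maps_add[OF g] linear_maps_smult[OF g] gg
    linear_maps_add[OF bl] linear_maps_add[OF br] linear_maps_smult[OF bl] linear_maps_smult[OF br]
  have sub: "submodule {x \<in> carrier free_VW. g x = \<zero>\<^bsub>U\<^esub>} K free_VW"
    by (rule submodule_linear_equalizer[OF F.module_axioms U g, of "\<lambda>_. \<zero>\<^bsub>U\<^esub>"]) (simp add: linear_maps_def)
  have "tensor_kernel K V W \<subseteq> {x \<in> carrier free_VW. g x = \<zero>\<^bsub>U\<^esub>}"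
    unfolding tensor_kernel_def
    by (rule submodule_span_least[OF sub])
      (auto simp: bilinear_relations_def Let_def free_gen_VW_closed gs bc a_minus_def[of U] U.r_neg)
  then have "g n = \<zero>\<^bsub>U\<^esub>" if "n \<in> tensor_kernel K V W" for n
    using that by blast
  from quotient_induced_map[OF F.module_axioms tensor_kernel_submodule U g this]
  obtain h where h: "h \<in> linear_maps K (tensor_product K V W) U"
    "\<And>x. x \<in> carrier free_VW \<Longrightarrow> h (tensor_kernel K V W +>\<^bsub>free_VW\<^esub> x) = g x"
    unfolding tensor_product_def by blast
  then show ?thesis
    by (intro bexI[of _ h]) (simp_all add: pure_tensor_def free_gen_VW_closed gg)
qed

lemma tensor_lift:
  assumes U: "module K U" and b: "b \<in> bilinear_maps K V W U"
  shows tensor_lift_linear: "tensor_lift K V W U b \<in> linear_maps K (tensor_product K V W) U"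
    and tensor_lift_pure: "\<lbrakk>v \<in> carrier V; w \<in> carrier W\<rbrakk> \<Longrightarrow>
      tensor_lift K V W U b (pure_tensor K V W v w) = b v w"
proof -
  let ?T = "tensor_product K V W"
  let ?P = "\<lambda>f. f \<in> linear_maps K ?T U \<and> f \<in> extensional (carrier ?T) \<and>
    (\<forall>v\<in>carrier V. \<forall>w\<in>carrier W. f (pure_tensor K V W v w) = b v w)"
  obtain f where f: "f \<in> linear_maps K ?T U"
    "\<forall>v\<in>carrier V. \<forall>w\<in>carrier W. f (pure_tensor K V W v w) = b v w"
    using tensor_product_universal[OF U b] by blast
  \<comment> \<open>The universal property fixes the lift on the carrier only; extensionality settles the rest.\<close>
  have "?P (restrict f (carrier ?T))"
    using f linear_maps_restrict[OF tensor_product_is_module f(1)] by (simp add: pure_tensor_closed)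
  moreover have "g = h" if "?P g" "?P h" for g h
    using that tensor_product_ext[OF U, of g h] by (intro extensionalityI[of g _ h]) auto
  ultimately have "\<exists>!f. ?P f" by blast
  then have *: "?P (tensor_lift K V W U b)"
    unfolding tensor_lift_def by (rule theI')
  show "tensor_lift K V W U b \<in> linear_maps K ?T U" using * by blast
  show "\<lbrakk>v \<in> carrier V; w \<in> carrier W\<rbrakk> \<Longrightarrow> tensor_lift K V W U b (pure_tensor K V W v w) = b v w"
    using * by blast
qed

text \<open>This is the form in which Sweedler notation uses the universal property: the value of a linear
  map at an arbitrary tensor is determined by its bilinear restriction to pure tensors.\<close>

lemma linear_map_as_tensor_lift:
  assumes U: "module K U" and f: "f \<in> linear_maps K (tensor_product K V W) U"
    and t: "t \<in> carrier (tensor_product K V W)"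
  shows "f t = tensor_lift K V W U (\<lambda>v w. f (pure_tensor K V W v w)) t"
proof -
  have b: "(\<lambda>v w. f (pure_tensor K V W v w)) \<in> bilinear_maps K V W U"
    by (intro bilinear_mapsI linear_maps_compose[OF f] bilinear_maps_left[OF pure_tensor_bilinear]
        bilinear_maps_right[OF pure_tensor_bilinear])
  show ?thesis
    by (rule tensor_product_ext[OF U f tensor_lift_linear[OF U b] _ t])
      (simp add: tensor_lift_pure[OF U b])
qed

end

section \<open>Canonical maps between tensor products\<close>

lemma bilinear_maps_compose:
  assumes b: "b \<in> bilinear_maps K V' W' U" and f: "f \<in> linear_maps K V V'" and g: "g \<in> linear_maps K W W'"
  shows "(\<lambda>v w. b (f v) (g w)) \<in> bilinear_maps K V W U"
  using linear_maps_closed[OF f] linear_maps_closed[OF g]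
  by (intro bilinear_mapsI linear_maps_compose[OF bilinear_maps_right[OF b] g]
      linear_maps_compose[OF bilinear_maps_left[OF b] f])

lemma bilinear_maps_swap:
  "b \<in> bilinear_maps K V W U \<Longrightarrow> (\<lambda>w v. b v w) \<in> bilinear_maps K W V U"
  by (simp add: bilinear_maps_def)

lemma tensor_map:
  assumes "module K V" "module K W" "module K V'" "module K W'"
    and f: "f \<in> linear_maps K V V'" and g: "g \<in> linear_maps K W W'"
  shows tensor_map_linear:
      "tensor_map K V W V' W' f g \<in> linear_maps K (tensor_product K V W) (tensor_product K V' W')"
    and tensor_map_pure: "\<lbrakk>v \<in> carrier V; w \<in> carrier W\<rbrakk> \<Longrightarrow>
      tensor_map K V W V' W' f g (pure_tensor K V W v w) = pure_tensor K V' W' (f v) (g w)"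
proof -
  note b = bilinear_maps_compose[OF pure_tensor_bilinear[OF assms(3,4)] f g]
  note M = tensor_product_is_module[OF assms(3,4)]
  show "tensor_map K V W V' W' f g \<in> linear_maps K (tensor_product K V W) (tensor_product K V' W')"
    unfolding tensor_map_def by (rule tensor_lift_linear[OF assms(1,2) M b])
  show "\<lbrakk>v \<in> carrier V; w \<in> carrier W\<rbrakk> \<Longrightarrow>
      tensor_map K V W V' W' f g (pure_tensor K V W v w) = pure_tensor K V' W' (f v) (g w)"
    unfolding tensor_map_def by (rule tensor_lift_pure[OF assms(1,2) M b])
qed

lemma tensor_flip:
  assumes V: "module K V" and W: "module K W"
  shows tensor_flip_linear:
      "tensor_flip K V W \<in> linear_maps K (tensor_product K V W) (tensor_product K W V)"
    and tensor_flip_pure: "\<lbrakk>v \<in> carrier V; w \<in> carrier W\<rbrakk> \<Longrightarrow>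
      tensor_flip K V W (pure_tensor K V W v w) = pure_tensor K W V w v"
proof -
  note b = bilinear_maps_swap[OF pure_tensor_bilinear[OF W V]]
  note M = tensor_product_is_module[OF W V]
  show "tensor_flip K V W \<in> linear_maps K (tensor_product K V W) (tensor_product K W V)"
    unfolding tensor_flip_def by (rule tensor_lift_linear[OF V W M b])
  show "\<lbrakk>v \<in> carrier V; w \<in> carrier W\<rbrakk> \<Longrightarrow>
      tensor_flip K V W (pure_tensor K V W v w) = pure_tensor K W V w v"
    unfolding tensor_flip_def by (rule tensor_lift_pure[OF V W M b])
qed

text \<open>By uniqueness: both sides of the additivity and homogeneity equations are linear in \<open>t\<close> and
  agree on pure tensors. This makes iterated lifts multilinear, as needed for maps out of threefold
  tensor products and for nested Sweedler sums.\<close>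

lemma tensor_lift_param_linear:
  assumes Z: "module K Z" and V: "module K V" and W: "module K W" and U: "module K U"
    and b: "\<And>z. z \<in> carrier Z \<Longrightarrow> b z \<in> bilinear_maps K V W U"
    and lin: "\<And>v w. \<lbrakk>v \<in> carrier V; w \<in> carrier W\<rbrakk> \<Longrightarrow> (\<lambda>z. b z v w) \<in> linear_maps K Z U"
    and t: "t \<in> carrier (tensor_product K V W)"
  shows "(\<lambda>z. tensor_lift K V W U (b z) t) \<in> linear_maps K Z U"
proof -
  interpret Z: module K Z by fact
  interpret U: module K U by fact
  note L = tensor_lift_linear[OF V W U b] and P = tensor_lift_pure[OF V W U b]
  note add = linear_maps_pointwise_add[OF U] and smult = linear_maps_pointwise_smult[OF U]
  show ?thesis
  proof (rule linear_mapsI)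
    fix x y assume A: "x \<in> carrier Z" "y \<in> carrier Z"
    show "tensor_lift K V W U (b (x \<oplus>\<^bsub>Z\<^esub> y)) t = tensor_lift K V W U (b x) t \<oplus>\<^bsub>U\<^esub> tensor_lift K V W U (b y) t"
      by (rule tensor_product_ext[OF V W U L[of "x \<oplus>\<^bsub>Z\<^esub> y"] add[OF L[of x] L[of y]] _ t]) (use A in \<open>simp_all add: P linear_maps_add[OF lin]\<close>)
  next
    fix c x assume A: "c \<in> carrier K" "x \<in> carrier Z"
    show "tensor_lift K V W U (b (c \<odot>\<^bsub>Z\<^esub> x)) t = c \<odot>\<^bsub>U\<^esub> tensor_lift K V W U (b x) t"
      by (rule tensor_product_ext[OF V W U L[of "c \<odot>\<^bsub>Z\<^esub> x"] smult[OF L[of x], of c] _ t]) (use A in \<open>simp_all add: P linear_maps_smult[OF lin]\<close>)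
  next
    fix x assume "x \<in> carrier Z"
    then show "tensor_lift K V W U (b x) t \<in> carrier U"
      using linear_maps_closed[OF L t] by blast
  qed
qed

lemma tensor_assoc:
  assumes U: "module K U" and V: "module K V" and W: "module K W"
  shows tensor_assoc_linear:
      "tensor_assoc K U V W \<in> linear_maps K (tensor_product K (tensor_product K U V) W)
        (tensor_product K U (tensor_product K V W))"
    and tensor_assoc_pure: "\<lbrakk>u \<in> carrier U; v \<in> carrier V; w \<in> carrier W\<rbrakk> \<Longrightarrow>
      tensor_assoc K U V W (pure_tensor K (tensor_product K U V) W (pure_tensor K U V u v) w) =
        pure_tensor K U (tensor_product K V W) u (pure_tensor K V W v w)"
proof -
  let ?VW = "tensor_product K V W" and ?UV = "tensor_product K U V"
  let ?T = "tensor_product K U ?VW"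
  note UV = tensor_product_is_module[OF U V] and VW = tensor_product_is_module[OF V W]
  note T = tensor_product_is_module[OF U VW]
  let ?b = "\<lambda>w u v. pure_tensor K U ?VW u (pure_tensor K V W v w)"
  note left = bilinear_maps_left[OF pure_tensor_bilinear] and right = bilinear_maps_right[OF pure_tensor_bilinear]
  note cl = pure_tensor_closed[OF V W]
  have b: "?b w \<in> bilinear_maps K U V ?T" if "w \<in> carrier W" for w
    by (intro bilinear_mapsI linear_maps_compose[OF right[OF U VW] left[OF V W]] left[OF U VW] cl that)
  have lin: "(\<lambda>w. ?b w u v) \<in> linear_maps K W ?T" if "u \<in> carrier U" "v \<in> carrier V" for u v
    by (intro linear_maps_compose[OF right[OF U VW] right[OF V W]] that)
  have B: "(\<lambda>t w. tensor_lift K U V ?T (?b w) t) \<in> bilinear_maps K ?UV W ?T"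
    by (rule bilinear_mapsI, rule tensor_lift_param_linear[OF W U V T b lin], assumption+,
        rule tensor_lift_linear[OF U V T b])
  have def: "tensor_assoc K U V W = tensor_lift K ?UV W ?T (\<lambda>t w. tensor_lift K U V ?T (?b w) t)"
    by (simp add: tensor_assoc_def Let_def)
  show "tensor_assoc K U V W \<in> linear_maps K (tensor_product K ?UV W) ?T"
    unfolding def by (rule tensor_lift_linear[OF UV W T B])
  show "tensor_assoc K U V W (pure_tensor K ?UV W (pure_tensor K U V u v) w) =
      pure_tensor K U ?VW u (pure_tensor K V W v w)"
    if "u \<in> carrier U" "v \<in> carrier V" "w \<in> carrier W"
    unfolding def tensor_lift_pure[OF UV W T B pure_tensor_closed[OF U V that(1,2)] that(3)]
    by (rule tensor_lift_pure[OF U V T b[OF that(3)] that(1,2)])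
qed

lemma tensor_assoc_inv:
  assumes U: "module K U" and V: "module K V" and W: "module K W"
  shows tensor_assoc_inv_linear:
      "tensor_assoc_inv K U V W \<in> linear_maps K (tensor_product K U (tensor_product K V W))
        (tensor_product K (tensor_product K U V) W)"
    and tensor_assoc_inv_pure: "\<lbrakk>u \<in> carrier U; v \<in> carrier V; w \<in> carrier W\<rbrakk> \<Longrightarrow>
      tensor_assoc_inv K U V W (pure_tensor K U (tensor_product K V W) u (pure_tensor K V W v w)) =
        pure_tensor K (tensor_product K U V) W (pure_tensor K U V u v) w"
proof -
  let ?VW = "tensor_product K V W" and ?UV = "tensor_product K U V"
  let ?T = "tensor_product K ?UV W"
  note UV = tensor_product_is_module[OF U V] and VW = tensor_product_is_module[OF V W]
  note T = tensor_product_is_module[OF UV W]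
  let ?b = "\<lambda>u v w. pure_tensor K ?UV W (pure_tensor K U V u v) w"
  note left = bilinear_maps_left[OF pure_tensor_bilinear] and right = bilinear_maps_right[OF pure_tensor_bilinear]
  note cl = pure_tensor_closed[OF U V]
  have b: "?b u \<in> bilinear_maps K V W ?T" if "u \<in> carrier U" for u
    by (intro bilinear_mapsI linear_maps_compose[OF left[OF UV W] right[OF U V]] right[OF UV W] cl that)
  have lin: "(\<lambda>u. ?b u v w) \<in> linear_maps K U ?T" if "v \<in> carrier V" "w \<in> carrier W" for v w
    by (intro linear_maps_compose[OF left[OF UV W] left[OF U V]] that)
  have B: "(\<lambda>u t. tensor_lift K V W ?T (?b u) t) \<in> bilinear_maps K U ?VW ?T"
    by (rule bilinear_mapsI, rule tensor_lift_linear[OF V W T b], assumption,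
        rule tensor_lift_param_linear[OF U V W T b lin])
  have def: "tensor_assoc_inv K U V W = tensor_lift K U ?VW ?T (\<lambda>u t. tensor_lift K V W ?T (?b u) t)"
    by (simp add: tensor_assoc_inv_def Let_def)
  show "tensor_assoc_inv K U V W \<in> linear_maps K (tensor_product K U ?VW) ?T"
    unfolding def by (rule tensor_lift_linear[OF U VW T B])
  show "tensor_assoc_inv K U V W (pure_tensor K U ?VW u (pure_tensor K V W v w)) =
      pure_tensor K ?UV W (pure_tensor K U V u v) w"
    if "u \<in> carrier U" "v \<in> carrier V" "w \<in> carrier W"
    unfolding def tensor_lift_pure[OF U VW T B that(1) pure_tensor_closed[OF V W that(2,3)]]
    by (rule tensor_lift_pure[OF V W T b[OF that(1)] that(2,3)])
qed

lemma middle_flip: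
  assumes V: "module K V"
  defines "VV \<equiv> tensor_product K V V"
  shows middle_flip_linear:
      "middle_flip K V \<in> linear_maps K (tensor_product K VV VV) (tensor_product K VV VV)"
    and middle_flip_pure: "\<lbrakk>a \<in> carrier V; b \<in> carrier V; c \<in> carrier V; d \<in> carrier V\<rbrakk> \<Longrightarrow>
      middle_flip K V (pure_tensor K VV VV (pure_tensor K V V a b) (pure_tensor K V V c d)) =
        pure_tensor K VV VV (pure_tensor K V V a c) (pure_tensor K V V b d)"
proof -
  have VV: "module K VV" unfolding VV_def by (intro tensor_product_is_module V)
  let ?V_VV = "tensor_product K V VV"
  have V_VV: "module K ?V_VV" by (intro tensor_product_is_module V VV)
  define inner where "inner = tensor_assoc K V V V \<circ> tensor_map K VV V VV V (tensor_flip K V V) id \<circ> tensor_assoc_inv K V V V"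
  note flip = tensor_flip_linear[OF V V, folded VV_def]
  note assoc = tensor_assoc_linear[OF V V V, folded VV_def] and assoc' = tensor_assoc_linear[OF V V VV, folded VV_def]
  note assoc_inv = tensor_assoc_inv_linear[OF V V V, folded VV_def]
    and assoc_inv' = tensor_assoc_inv_linear[OF V V VV, folded VV_def]
  have inner: "inner \<in> linear_maps K ?V_VV ?V_VV"
    unfolding inner_def
    by (rule linear_maps_comp[OF assoc_inv linear_maps_comp[OF tensor_map_linear[OF VV V VV V flip linear_maps_id] assoc]])
  have middle: "middle_flip K V = tensor_assoc_inv K V V VV \<circ> tensor_map K V ?V_VV V ?V_VV id inner \<circ> tensor_assoc K V V VV"
    by (simp add: middle_flip_def Let_def VV_def inner_def)
  show "middle_flip K V \<in> linear_maps K (tensor_product K VV VV) (tensor_product K VV VV)"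
    unfolding middle
    by (rule linear_maps_comp[OF assoc' linear_maps_comp[OF tensor_map_linear[OF V V_VV V V_VV linear_maps_id inner] assoc_inv']])
  assume abcd: "a \<in> carrier V" "b \<in> carrier V" "c \<in> carrier V" "d \<in> carrier V"
  note cl = pure_tensor_closed[OF V V, folded VV_def]
  have "inner (pure_tensor K V VV b (pure_tensor K V V c d)) = pure_tensor K V VV c (pure_tensor K V V b d)"
    unfolding inner_def using abcd
    by (simp add: tensor_assoc_inv_pure[OF V V V, folded VV_def] tensor_assoc_pure[OF V V V, folded VV_def]
      tensor_map_pure[OF VV V VV V flip linear_maps_id] cl tensor_flip_pure[OF V V])
  then show "middle_flip K V (pure_tensor K VV VV (pure_tensor K V V a b) (pure_tensor K V V c d)) =
        pure_tensor K VV VV (pure_tensor K V V a c) (pure_tensor K V V b d)"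
    unfolding middle using abcd
    by (simp add: tensor_assoc_pure[OF V V VV, folded VV_def] tensor_assoc_inv_pure[OF V V VV, folded VV_def]
      tensor_map_pure[OF V V_VV V V_VV linear_maps_id inner] cl pure_tensor_closed[OF V VV])
qed

section \<open>Hopf algebras in Sweedler notation\<close>

text \<open>The defining description of the lift mentions the bilinear map on the carriers only. This is
  what allows summands to be rewritten under a Sweedler sum.\<close>

lemma tensor_lift_cong:
  assumes "\<And>v w. \<lbrakk>v \<in> carrier V; w \<in> carrier W\<rbrakk> \<Longrightarrow> b v w = b' v w"
  shows "tensor_lift K V W U b = tensor_lift K V W U b'"
  using assms by (simp add: tensor_lift_def)

lemma ground_module_is_module:
  assumes "cring K"
  shows "module K (ground_module K)"
proof -
  interpret K: cring K by fact
  show ?thesis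
  proof (rule moduleI)
    show "abelian_group (ground_module K)"
      by (rule abelian_groupI) (auto simp: ground_module_def K.a_ac intro!: K.add.l_inv_ex)
  qed (auto simp: ground_module_def K.l_distr K.r_distr K.m_assoc K.cring_axioms)
qed

context hopf_algebra
begin

lemma field_algebra_H: "field_algebra K H"
  by (rule hopf_algebra.axioms(1)[OF hopf_algebra_axioms])

lemma module_H: "module K H"
  by (rule field_algebra.axioms(2)[OF field_algebra_H])

abbreviation HH :: "('k, ('h \<times> 'h \<Rightarrow> 'k) set) module"
  where "HH \<equiv> tensor_product K H H"

abbreviation tensor (infixr \<open>\<otimes>\<^sub>t\<close> 65)
  where "x \<otimes>\<^sub>t y \<equiv> pure_tensor K H H x y"

abbreviation mult_H (infixl \<open>\<star>\<close> 70)
  where "x \<star> y \<equiv> x \<otimes>\<^bsub>H\<^esub> y"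

abbreviation lin :: "('h \<Rightarrow> 'h) \<Rightarrow> bool"
  where "lin f \<equiv> f \<in> linear_maps K H H"

abbreviation bilin :: "('h \<Rightarrow> 'h \<Rightarrow> 'h) \<Rightarrow> bool"
  where "bilin b \<equiv> b \<in> bilinear_maps K H H H"

text \<open>If \<open>\<Delta> x = \<Sum> a\<^sub>i \<otimes> b\<^sub>i\<close>, this is \<open>\<Sum> f(a\<^sub>i, b\<^sub>i)\<close> for bilinear \<open>f\<close>; Sweedler notation writes
  \<open>f(x\<^sub>1, x\<^sub>2)\<close>. Going through the lift avoids the choice of a decomposition.\<close>

definition sweedler :: "'h \<Rightarrow> ('h \<Rightarrow> 'h \<Rightarrow> 'h) \<Rightarrow> 'h"
  where "sweedler x f = tensor_lift K H H H f (\<Delta> x)"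

lemma module_HH: "module K HH"
  by (intro tensor_product_is_module module_H)

lemma comult_closed: "x \<in> carrier H \<Longrightarrow> \<Delta> x \<in> carrier HH"
  by (rule linear_maps_closed[OF comult_linear])

lemma counit_closed: "x \<in> carrier H \<Longrightarrow> \<epsilon> x \<in> carrier K"
  using linear_maps_closed[OF counit_linear] by (simp add: ground_module_def)

lemma antipode_closed: "x \<in> carrier H \<Longrightarrow> S x \<in> carrier H"
  by (rule linear_maps_closed[OF antipode_linear])

lemma sweedler_cong:
  assumes "x = y"
    and "\<And>a b. \<lbrakk>a \<in> carrier H; b \<in> carrier H\<rbrakk> \<Longrightarrow> f a b = g a b"
  shows "sweedler x f = sweedler y g"
  by (simp add: sweedler_def assms(1) tensor_lift_cong[of H H f g, OF assms(2)])

lemma linear_map_comult: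
  assumes "f \<in> linear_maps K HH H" "x \<in> carrier H"
  shows "f (\<Delta> x) = sweedler x (\<lambda>a b. f (a \<otimes>\<^sub>t b))"
  unfolding sweedler_def
  by (rule linear_map_as_tensor_lift[OF module_H module_H module_H assms(1) comult_closed[OF assms(2)]])

lemma sweedler_closed: "\<lbrakk>bilin b; x \<in> carrier H\<rbrakk> \<Longrightarrow> sweedler x b \<in> carrier H"
  unfolding sweedler_def
  by (rule linear_maps_closed[OF tensor_lift_linear[OF module_H module_H module_H] comult_closed])

lemma lin_sweedler_arg: "\<lbrakk>bilin b; lin f\<rbrakk> \<Longrightarrow> lin (\<lambda>x. sweedler (f x) b)"
  unfolding sweedler_def
  by (intro linear_maps_compose[OF tensor_lift_linear[OF module_H module_H module_H]]
      linear_maps_compose[OF comult_linear])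

lemma lin_sweedler_param:
  assumes "\<And>z. z \<in> carrier H \<Longrightarrow> bilin (b z)"
    and "\<And>a c. \<lbrakk>a \<in> carrier H; c \<in> carrier H\<rbrakk> \<Longrightarrow> lin (\<lambda>z. b z a c)" and "x \<in> carrier H"
  shows "lin (\<lambda>z. sweedler x (b z))"
  unfolding sweedler_def
  by (rule tensor_lift_param_linear[OF module_H module_H module_H module_H assms(1,2) comult_closed[OF assms(3)]])

lemma sweedler_natural:
  assumes "lin f" "bilin b" "x \<in> carrier H"
  shows "f (sweedler x b) = sweedler x (\<lambda>a c. f (b a c))"
proof -
  note M = module_H module_H module_H
  have "f (tensor_lift K H H H b (\<Delta> x)) = sweedler x (\<lambda>a c. f (tensor_lift K H H H b (a \<otimes>\<^sub>t c)))"
    by (rule linear_map_comult[OF linear_maps_compose[OF assms(1) tensor_lift_linear[OF M assms(2)]] assms(3)])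
  also have "\<dots> = sweedler x (\<lambda>a c. f (b a c))"
    by (rule sweedler_cong) (simp_all add: tensor_lift_pure[OF M assms(2)])
  finally show ?thesis by (simp add: sweedler_def)
qed

lemma lin_mult_left: "\<lbrakk>lin f; c \<in> carrier H\<rbrakk> \<Longrightarrow> lin (\<lambda>x. c \<star> f x)"
  by (intro linear_mapsI) (simp_all add: linear_maps_closed linear_maps_add linear_maps_smult r_distr smult_mult_right)

lemma lin_mult_right: "\<lbrakk>lin f; c \<in> carrier H\<rbrakk> \<Longrightarrow> lin (\<lambda>x. f x \<star> c)"
  by (intro linear_mapsI) (simp_all add: linear_maps_closed linear_maps_add linear_maps_smult l_distr smult_mult_left)

lemma lin_antipode: "lin f \<Longrightarrow> lin (\<lambda>x. S (f x))"
  by (rule linear_maps_compose[OF antipode_linear])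

lemma lin_smult: "\<lbrakk>lin f; c \<in> carrier K\<rbrakk> \<Longrightarrow> lin (\<lambda>x. c \<odot>\<^bsub>H\<^esub> f x)"
  by (rule linear_maps_pointwise_smult[OF module_H])

lemma lin_counit_smult: "\<lbrakk>lin f; c \<in> carrier H\<rbrakk> \<Longrightarrow> lin (\<lambda>x. \<epsilon> (f x) \<odot>\<^bsub>H\<^esub> c)"
  using linear_maps_add[OF counit_linear] linear_maps_smult[OF counit_linear]
  by (intro linear_mapsI)
    (simp_all add: linear_maps_closed linear_maps_add linear_maps_smult counit_closed ground_module_def
      smult_l_distr smult_assoc1)

text \<open>Applied backwards, these rules prove multilinearity of expressions built from products, the
  antipode, scalars and Sweedler sums: the shape of the expression determines the rule, because a
  subterm that contains the bound variable cannot be matched by a constant.\<close>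

lemmas linearity = bilinear_mapsI linear_maps_ident lin_mult_left lin_mult_right lin_antipode lin_smult
  lin_counit_smult lin_sweedler_arg lin_sweedler_param m_closed one_closed antipode_closed counit_closed
  sweedler_closed smult_closed

text \<open>Both sides are the values of one linear map on \<open>H \<otimes> (H \<otimes> H)\<close>, the lift \<open>F\<close> of the trilinear
  \<open>f\<close>, at the two sides of the coassociativity axiom.\<close>

lemma sweedler_coassoc:
  assumes x: "x \<in> carrier H"
    and f12: "\<And>c. c \<in> carrier H \<Longrightarrow> bilin (\<lambda>a b. f a b c)"
    and f23: "\<And>a. a \<in> carrier H \<Longrightarrow> bilin (f a)"
  shows "sweedler x (\<lambda>p c. sweedler p (\<lambda>a b. f a b c)) = sweedler x (\<lambda>a p. sweedler p (f a))"
proof -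
  note M = module_H and MM = module_HH
  let ?T = "tensor_product K H HH" and ?T' = "tensor_product K HH H"
  define F where "F = tensor_lift K H HH H (\<lambda>a. tensor_lift K H H H (f a))"
  have f1: "lin (\<lambda>a. f a b c)" if "b \<in> carrier H" "c \<in> carrier H" for b c
    using bilinear_maps_left[OF f12] that by blast
  have B: "(\<lambda>a. tensor_lift K H H H (f a)) \<in> bilinear_maps K H HH H"
    by (rule bilinear_mapsI, rule tensor_lift_linear[OF M M M f23], assumption,
        rule tensor_lift_param_linear[OF M M M M f23 f1])
  have F: "F \<in> linear_maps K ?T H"
    unfolding F_def by (rule tensor_lift_linear[OF M MM M B])
  have F_pure: "F (pure_tensor K H HH a (b \<otimes>\<^sub>t c)) = f a b c"
    if "a \<in> carrier H" "b \<in> carrier H" "c \<in> carrier H" for a b c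
    unfolding F_def
    using that by (simp add: tensor_lift_pure[OF M MM M B] tensor_lift_pure[OF M M M f23] pure_tensor_closed[OF M M])
  let ?\<alpha> = "tensor_assoc K H H H"
  note assoc = tensor_assoc_linear[OF M M M]
  note left = tensor_map_linear[OF M M MM M comult_linear linear_maps_id]
  note right = tensor_map_linear[OF M M M MM linear_maps_id comult_linear]
  have "F (?\<alpha> (tensor_map K H H HH H \<Delta> id (\<Delta> x))) =
      sweedler x (\<lambda>p c. F (?\<alpha> (tensor_map K H H HH H \<Delta> id (p \<otimes>\<^sub>t c))))"
    by (rule linear_map_comult[OF linear_maps_compose[OF F linear_maps_compose[OF assoc left]] x])
  also have "\<dots> = sweedler x (\<lambda>p c. sweedler p (\<lambda>a b. f a b c))"
  proof (rule sweedler_cong[OF refl])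
    fix p c assume p: "p \<in> carrier H" and c: "c \<in> carrier H"
    have "F (?\<alpha> (tensor_map K H H HH H \<Delta> id (p \<otimes>\<^sub>t c))) = F (?\<alpha> (pure_tensor K HH H (\<Delta> p) c))"
      using p c by (simp add: tensor_map_pure[OF M M MM M comult_linear linear_maps_id])
    also have "\<dots> = sweedler p (\<lambda>a b. F (?\<alpha> (pure_tensor K HH H (a \<otimes>\<^sub>t b) c)))"
      by (rule linear_map_comult[OF linear_maps_compose[OF F linear_maps_compose[OF assoc
              bilinear_maps_left[OF pure_tensor_bilinear[OF MM M] c]]] p])
    also have "\<dots> = sweedler p (\<lambda>a b. f a b c)"
      using c by (intro sweedler_cong) (simp_all add: tensor_assoc_pure[OF M M M] F_pure)
    finally show "F (?\<alpha> (tensor_map K H H HH H \<Delta> id (p \<otimes>\<^sub>t c))) = sweedler p (\<lambda>a b. f a b c)" .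
  qed
  finally have 1: "F (?\<alpha> (tensor_map K H H HH H \<Delta> id (\<Delta> x))) = sweedler x (\<lambda>p c. sweedler p (\<lambda>a b. f a b c))" .
  have "F (tensor_map K H H H HH id \<Delta> (\<Delta> x)) =
      sweedler x (\<lambda>a p. F (tensor_map K H H H HH id \<Delta> (a \<otimes>\<^sub>t p)))"
    by (rule linear_map_comult[OF linear_maps_compose[OF F right] x])
  also have "\<dots> = sweedler x (\<lambda>a p. sweedler p (f a))"
  proof (rule sweedler_cong[OF refl])
    fix a p assume a: "a \<in> carrier H" and p: "p \<in> carrier H"
    have "F (tensor_map K H H H HH id \<Delta> (a \<otimes>\<^sub>t p)) = F (pure_tensor K H HH a (\<Delta> p))"
      using p a by (simp add: tensor_map_pure[OF M M M MM linear_maps_id comult_linear])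
    also have "\<dots> = sweedler p (\<lambda>b c. F (pure_tensor K H HH a (b \<otimes>\<^sub>t c)))"
      by (rule linear_map_comult[OF linear_maps_compose[OF F
              bilinear_maps_right[OF pure_tensor_bilinear[OF M MM] a]] p])
    also have "\<dots> = sweedler p (f a)"
      using a by (intro sweedler_cong) (simp_all add: F_pure)
    finally show "F (tensor_map K H H H HH id \<Delta> (a \<otimes>\<^sub>t p)) = sweedler p (f a)" .
  qed
  finally have 2: "F (tensor_map K H H H HH id \<Delta> (\<Delta> x)) = sweedler x (\<lambda>a p. sweedler p (f a))" .
  show ?thesis using 1 2 coassoc[OF x] by simp
qed

lemma bilin_mult: "bilin (mult H)"
  by (intro linearity)

lemma mult_map_linear: "mult_map K H \<in> linear_maps K HH H"
  unfolding mult_map_def by (rule tensor_lift_linear[OF module_H module_H module_H bilin_mult])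

lemma mult_map_pure: "\<lbrakk>x \<in> carrier H; y \<in> carrier H\<rbrakk> \<Longrightarrow> mult_map K H (x \<otimes>\<^sub>t y) = x \<star> y"
  unfolding mult_map_def by (rule tensor_lift_pure[OF module_H module_H module_H bilin_mult])

lemma sweedler_antipode_left:
  assumes x: "x \<in> carrier H"
  shows "sweedler x (\<lambda>a b. S a \<star> b) = \<epsilon> x \<odot>\<^bsub>H\<^esub> \<one>\<^bsub>H\<^esub>"
proof -
  note M = module_H
  let ?f = "tensor_map K H H H H S id"
  have "mult_map K H (?f (\<Delta> x)) = sweedler x (\<lambda>a b. mult_map K H (?f (a \<otimes>\<^sub>t b)))"
    by (rule linear_map_comult[OF linear_maps_compose[OF mult_map_linear
            tensor_map_linear[OF M M M M antipode_linear linear_maps_id]] x])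
  also have "\<dots> = sweedler x (\<lambda>a b. S a \<star> b)"
    by (rule sweedler_cong)
      (simp_all add: tensor_map_pure[OF M M M M antipode_linear linear_maps_id] mult_map_pure antipode_closed)
  finally show ?thesis using antipode_left[OF x] by simp
qed

lemma sweedler_antipode_right:
  assumes x: "x \<in> carrier H"
  shows "sweedler x (\<lambda>a b. a \<star> S b) = \<epsilon> x \<odot>\<^bsub>H\<^esub> \<one>\<^bsub>H\<^esub>"
proof -
  note M = module_H
  let ?f = "tensor_map K H H H H id S"
  have "mult_map K H (?f (\<Delta> x)) = sweedler x (\<lambda>a b. mult_map K H (?f (a \<otimes>\<^sub>t b)))"
    by (rule linear_map_comult[OF linear_maps_compose[OF mult_map_linear
            tensor_map_linear[OF M M M M linear_maps_id antipode_linear]] x])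
  also have "\<dots> = sweedler x (\<lambda>a b. a \<star> S b)"
    by (rule sweedler_cong)
      (simp_all add: tensor_map_pure[OF M M M M linear_maps_id antipode_linear] mult_map_pure antipode_closed)
  finally show ?thesis using antipode_right[OF x] by simp
qed

lemma sweedler_counit_left:
  assumes x: "x \<in> carrier H"
  shows "sweedler x (\<lambda>a b. \<epsilon> a \<odot>\<^bsub>H\<^esub> b) = x"
proof -
  note M = module_H
  let ?G = "ground_module K"
  have G: "module K ?G" by (rule ground_module_is_module) (rule cring_axioms)
  have B: "smult H \<in> bilinear_maps K ?G H H"
    by (intro bilinear_mapsI linear_mapsI)
      (auto simp: ground_module_def smult_l_distr smult_r_distr smult_assoc1[symmetric] m_comm)
  let ?f = "tensor_map K H H ?G H \<epsilon> id" and ?g = "tensor_lift K ?G H H (smult H)"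
  have "?g (?f (\<Delta> x)) = sweedler x (\<lambda>a b. ?g (?f (a \<otimes>\<^sub>t b)))"
    by (rule linear_map_comult[OF linear_maps_compose[OF tensor_lift_linear[OF G M M B]
            tensor_map_linear[OF M M G M counit_linear linear_maps_id]] x])
  also have "\<dots> = sweedler x (\<lambda>a b. \<epsilon> a \<odot>\<^bsub>H\<^esub> b)"
    by (rule sweedler_cong)
      (simp_all add: tensor_map_pure[OF M M G M counit_linear linear_maps_id]
        tensor_lift_pure[OF G M M B] linear_maps_closed[OF counit_linear])
  finally show ?thesis using counit_left[OF x] by simp
qed

lemma sweedler_counit_right:
  assumes x: "x \<in> carrier H"
  shows "sweedler x (\<lambda>a b. \<epsilon> b \<odot>\<^bsub>H\<^esub> a) = x"
proof -
  note M = module_H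
  let ?G = "ground_module K"
  have G: "module K ?G" by (rule ground_module_is_module) (rule cring_axioms)
  have B: "(\<lambda>y c. c \<odot>\<^bsub>H\<^esub> y) \<in> bilinear_maps K H ?G H"
    by (intro bilinear_mapsI linear_mapsI)
      (auto simp: ground_module_def smult_l_distr smult_r_distr smult_assoc1[symmetric] m_comm)
  let ?f = "tensor_map K H H H ?G id \<epsilon>" and ?g = "tensor_lift K H ?G H (\<lambda>y c. c \<odot>\<^bsub>H\<^esub> y)"
  have "?g (?f (\<Delta> x)) = sweedler x (\<lambda>a b. ?g (?f (a \<otimes>\<^sub>t b)))"
    by (rule linear_map_comult[OF linear_maps_compose[OF tensor_lift_linear[OF M G M B]
            tensor_map_linear[OF M M M G linear_maps_id counit_linear]] x])
  also have "\<dots> = sweedler x (\<lambda>a b. \<epsilon> b \<odot>\<^bsub>H\<^esub> a)"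
    by (rule sweedler_cong)
      (simp_all add: tensor_map_pure[OF M M M G linear_maps_id counit_linear]
        tensor_lift_pure[OF M G M B] linear_maps_closed[OF counit_linear])
  finally show ?thesis using counit_right[OF x] by simp
qed

text \<open>Multiplicativity of \<open>\<Delta>\<close>, unfolded one tensor factor at a time. The sum over \<open>y\<close> is put
  outside because it is the outer one both where the antipode is expanded on products and in the
  action law, so that no sums have to be exchanged there.\<close>

lemma sweedler_mult:
  assumes x: "x \<in> carrier H" and y: "y \<in> carrier H" and b: "bilin b"
  shows "sweedler (x \<star> y) b = sweedler y (\<lambda>c d. sweedler x (\<lambda>a a'. b (a \<star> c) (a' \<star> d)))"
proof -
  note M = module_H and MM = module_HH
  let ?m = "tensor_map K HH HH H H (mult_map K H) (mult_map K H)"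
  define g where "g t = tensor_lift K H H H b (?m (middle_flip K H t))" for t
  have g: "g \<in> linear_maps K (tensor_product K HH HH) H"
    unfolding g_def
    by (intro linear_maps_compose[OF tensor_lift_linear[OF M M M b]]
        linear_maps_compose[OF tensor_map_linear[OF MM MM M M mult_map_linear mult_map_linear]]
        middle_flip_linear M)
  have g_pure: "g (pure_tensor K HH HH (a \<otimes>\<^sub>t a') (c \<otimes>\<^sub>t d)) = b (a \<star> c) (a' \<star> d)"
    if "a \<in> carrier H" "a' \<in> carrier H" "c \<in> carrier H" "d \<in> carrier H" for a a' c d
    unfolding g_def using that
    by (simp add: middle_flip_pure[OF M] tensor_map_pure[OF MM MM M M mult_map_linear mult_map_linear]
        pure_tensor_closed[OF M M] mult_map_pure tensor_lift_pure[OF M M M b])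
  have "sweedler (x \<star> y) b = g (pure_tensor K HH HH (\<Delta> x) (\<Delta> y))"
    by (simp add: sweedler_def g_def comult_mult[OF x y])
  also have "\<dots> = sweedler y (\<lambda>c d. g (pure_tensor K HH HH (\<Delta> x) (c \<otimes>\<^sub>t d)))"
    by (rule linear_map_comult[OF linear_maps_compose[OF g
            bilinear_maps_right[OF pure_tensor_bilinear[OF MM MM] comult_closed[OF x]]] y])
  also have "\<dots> = sweedler y (\<lambda>c d. sweedler x (\<lambda>a a'. b (a \<star> c) (a' \<star> d)))"
  proof (rule sweedler_cong[OF refl])
    fix c d assume cd: "c \<in> carrier H" "d \<in> carrier H"
    have "g (pure_tensor K HH HH (\<Delta> x) (c \<otimes>\<^sub>t d)) =
        sweedler x (\<lambda>a a'. g (pure_tensor K HH HH (a \<otimes>\<^sub>t a') (c \<otimes>\<^sub>t d)))"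
      by (rule linear_map_comult[OF linear_maps_compose[OF g
              bilinear_maps_left[OF pure_tensor_bilinear[OF MM MM] pure_tensor_closed[OF M M cd]]] x])
    also have "\<dots> = sweedler x (\<lambda>a a'. b (a \<star> c) (a' \<star> d))"
      using cd by (intro sweedler_cong) (simp_all add: g_pure)
    finally show "g (pure_tensor K HH HH (\<Delta> x) (c \<otimes>\<^sub>t d)) = sweedler x (\<lambda>a a'. b (a \<star> c) (a' \<star> d))" .
  qed
  finally show ?thesis .
qed

section \<open>The antipode is an antihomomorphism\<close>

text \<open>In Sweedler notation, \<open>g(y\<^sub>1) y\<^sub>2 S(y\<^sub>3) = g(y)\<close>: coassociativity makes \<open>y\<^sub>2 S(y\<^sub>3)\<close> an inner
  sum, which the antipode axiom replaces by a counit.\<close>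

lemma convolution_cancel:
  assumes g: "lin g" and y: "y \<in> carrier H"
  shows "sweedler y (\<lambda>p c. sweedler p (\<lambda>a b. g a \<star> b) \<star> S c) = g y"
proof -
  note gc = linear_maps_closed[OF g]
  note gl = linear_maps_compose[OF g]
  have "sweedler y (\<lambda>p c. sweedler p (\<lambda>a b. g a \<star> b) \<star> S c)
      = sweedler y (\<lambda>p c. sweedler p (\<lambda>a b. g a \<star> b \<star> S c))"
  proof (rule sweedler_cong[OF refl])
    fix p c assume pc: "p \<in> carrier H" "c \<in> carrier H"
    show "sweedler p (\<lambda>a b. g a \<star> b) \<star> S c = sweedler p (\<lambda>a b. g a \<star> b \<star> S c)"
      by (rule sweedler_natural[of "\<lambda>z. z \<star> S c"]; intro linearity g gc pc)
  qed
  also have "\<dots> = sweedler y (\<lambda>a p. sweedler p (\<lambda>b c. g a \<star> b \<star> S c))"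
    by (rule sweedler_coassoc[OF y]; intro linearity g gc)
  also have "\<dots> = sweedler y (\<lambda>a p. g (\<epsilon> p \<odot>\<^bsub>H\<^esub> a))"
  proof (rule sweedler_cong[OF refl])
    fix a p assume ap: "a \<in> carrier H" "p \<in> carrier H"
    have "sweedler p (\<lambda>b c. g a \<star> b \<star> S c) = sweedler p (\<lambda>b c. g a \<star> (b \<star> S c))"
      using ap by (intro sweedler_cong) (simp_all add: m_assoc gc antipode_closed)
    also have "\<dots> = g a \<star> sweedler p (\<lambda>b c. b \<star> S c)"
      by (rule sweedler_natural[of "\<lambda>z. g a \<star> z", symmetric]; intro linearity g gc ap)
    also have "\<dots> = g (\<epsilon> p \<odot>\<^bsub>H\<^esub> a)"
      using ap by (simp add: sweedler_antipode_right smult_mult_right gc counit_closed linear_maps_smult[OF g])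
    finally show "sweedler p (\<lambda>b c. g a \<star> b \<star> S c) = g (\<epsilon> p \<odot>\<^bsub>H\<^esub> a)" .
  qed
  also have "\<dots> = g (sweedler y (\<lambda>a p. \<epsilon> p \<odot>\<^bsub>H\<^esub> a))"
    by (rule sweedler_natural[symmetric]; intro linearity g y)
  also have "\<dots> = g y" by (simp add: sweedler_counit_right[OF y])
  finally show ?thesis .
qed

text \<open>Thus \<open>g * id = h\<close> in the convolution algebra can be solved for \<open>g = h * S\<close>. The equation for \<open>S\<close>
  on products is obtained by applying this twice, with one argument frozen each time.\<close>

lemma convolution_solve:
  assumes g: "lin g" and y: "y \<in> carrier H"
    and h: "\<And>p. p \<in> carrier H \<Longrightarrow> sweedler p (\<lambda>a b. g a \<star> b) = h p"
  shows "g y = sweedler y (\<lambda>p c. h p \<star> S c)"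
proof -
  have "g y = sweedler y (\<lambda>p c. sweedler p (\<lambda>a b. g a \<star> b) \<star> S c)"
    by (rule convolution_cancel[OF g y, symmetric])
  also have "\<dots> = sweedler y (\<lambda>p c. h p \<star> S c)"
    by (rule sweedler_cong) (simp_all add: h)
  finally show ?thesis .
qed

text \<open>As a function of \<open>y\<close>, the left side \<open>G\<close> satisfies
  \<open>G(y\<^sub>1) y\<^sub>2 = S(x\<^sub>1 y\<^sub>1) x\<^sub>2 y\<^sub>2 = \<epsilon>(x y) 1\<close>, by the antipode axiom for \<open>x y\<close>; solve for \<open>G\<close>.\<close>

lemma antipode_mult_convolution:
  assumes x: "x \<in> carrier H" and y: "y \<in> carrier H"
  shows "sweedler x (\<lambda>a b. S (a \<star> y) \<star> b) = \<epsilon> x \<odot>\<^bsub>H\<^esub> S y"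
proof -
  define G where "G y = sweedler x (\<lambda>a b. S (a \<star> y) \<star> b)" for y
  have G: "lin G"
    unfolding G_def by (intro linearity x)
  have "sweedler p (\<lambda>c d. G c \<star> d) = (\<epsilon> x \<otimes>\<^bsub>K\<^esub> \<epsilon> p) \<odot>\<^bsub>H\<^esub> \<one>\<^bsub>H\<^esub>" if p: "p \<in> carrier H" for p
  proof -
    have "sweedler p (\<lambda>c d. G c \<star> d) = sweedler p (\<lambda>c d. sweedler x (\<lambda>a b. S (a \<star> c) \<star> (b \<star> d)))"
    proof (rule sweedler_cong[OF refl])
      fix c d assume cd: "c \<in> carrier H" "d \<in> carrier H"
      have "G c \<star> d = sweedler x (\<lambda>a b. S (a \<star> c) \<star> b \<star> d)"
        unfolding G_def by (rule sweedler_natural[of "\<lambda>z. z \<star> d"]; intro linearity x cd)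
      also have "\<dots> = sweedler x (\<lambda>a b. S (a \<star> c) \<star> (b \<star> d))"
        using cd by (intro sweedler_cong) (simp_all add: m_assoc antipode_closed)
      finally show "G c \<star> d = sweedler x (\<lambda>a b. S (a \<star> c) \<star> (b \<star> d))" .
    qed
    also have "\<dots> = sweedler (x \<star> p) (\<lambda>a b. S a \<star> b)"
      by (rule sweedler_mult[OF x p, symmetric]) (intro linearity)
    also have "\<dots> = (\<epsilon> x \<otimes>\<^bsub>K\<^esub> \<epsilon> p) \<odot>\<^bsub>H\<^esub> \<one>\<^bsub>H\<^esub>"
      using x p by (simp add: sweedler_antipode_left counit_mult)
    finally show ?thesis .
  qed
  then have "G y = sweedler y (\<lambda>p c. (\<epsilon> x \<otimes>\<^bsub>K\<^esub> \<epsilon> p) \<odot>\<^bsub>H\<^esub> \<one>\<^bsub>H\<^esub> \<star> S c)"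
    by (rule convolution_solve[OF G y])
  also have "\<dots> = sweedler y (\<lambda>p c. \<epsilon> x \<odot>\<^bsub>H\<^esub> S (\<epsilon> p \<odot>\<^bsub>H\<^esub> c))"
    using x by (intro sweedler_cong)
      (simp_all add: smult_mult_left counit_closed antipode_closed smult_assoc1 linear_maps_smult[OF antipode_linear])
  also have "\<dots> = \<epsilon> x \<odot>\<^bsub>H\<^esub> S (sweedler y (\<lambda>p c. \<epsilon> p \<odot>\<^bsub>H\<^esub> c))"
    by (rule sweedler_natural[of "\<lambda>z. \<epsilon> x \<odot>\<^bsub>H\<^esub> S z", symmetric]; intro linearity x y)
  finally show ?thesis by (simp add: G_def sweedler_counit_left[OF y])
qed

text \<open>Now \<open>y\<close> is frozen and the previous lemma is solved for \<open>x \<mapsto> S(x y)\<close>.\<close>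

lemma antipode_mult:
  assumes x: "x \<in> carrier H" and y: "y \<in> carrier H"
  shows "S (x \<star> y) = S y \<star> S x"
proof -
  have "S (x \<star> y) = sweedler x (\<lambda>p c. \<epsilon> p \<odot>\<^bsub>H\<^esub> S y \<star> S c)"
    by (rule convolution_solve[of "\<lambda>x. S (x \<star> y)", OF _ x antipode_mult_convolution[OF _ y]])
      (intro linearity y)
  also have "\<dots> = sweedler x (\<lambda>p c. S y \<star> S (\<epsilon> p \<odot>\<^bsub>H\<^esub> c))"
    using y by (intro sweedler_cong)
      (simp_all add: smult_mult_left smult_mult_right counit_closed antipode_closed linear_maps_smult[OF antipode_linear])
  also have "\<dots> = S y \<star> S (sweedler x (\<lambda>p c. \<epsilon> p \<odot>\<^bsub>H\<^esub> c))"
    by (rule sweedler_natural[of "\<lambda>z. S y \<star> S z", symmetric]; intro linearity x y)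
  also have "\<dots> = S y \<star> S x" by (simp add: sweedler_counit_left[OF x])
  finally show ?thesis .
qed

section \<open>The adjoint action\<close>

definition adj :: "'h \<Rightarrow> 'h \<Rightarrow> 'h"
  where "adj x y = sweedler y (\<lambda>a b. S a \<star> (x \<star> b))"

lemma adj_closed: "\<lbrakk>x \<in> carrier H; y \<in> carrier H\<rbrakk> \<Longrightarrow> adj x y \<in> carrier H"
  unfolding adj_def by (intro linearity)

lemma lin_adj: "\<lbrakk>lin f; x \<in> carrier H\<rbrakk> \<Longrightarrow> lin (\<lambda>y. adj x (f y))"
  unfolding adj_def by (intro linearity)

text \<open>The adjoint action is a right action, because \<open>\<Delta>\<close> is multiplicative and \<open>S\<close> reverses products.\<close>

lemma adj_mult:
  assumes x: "x \<in> carrier H" and y: "y \<in> carrier H" and z: "z \<in> carrier H"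
  shows "adj x (y \<star> z) = adj (adj x y) z"
proof -
  have "adj x (y \<star> z) = sweedler z (\<lambda>c d. sweedler y (\<lambda>a b. S (a \<star> c) \<star> (x \<star> (b \<star> d))))"
    unfolding adj_def by (rule sweedler_mult[OF y z]) (intro linearity x)
  also have "\<dots> = sweedler z (\<lambda>c d. S c \<star> (adj x y \<star> d))"
  proof (rule sweedler_cong[OF refl])
    fix c d assume cd: "c \<in> carrier H" "d \<in> carrier H"
    have "sweedler y (\<lambda>a b. S (a \<star> c) \<star> (x \<star> (b \<star> d))) = sweedler y (\<lambda>a b. S c \<star> (S a \<star> (x \<star> b) \<star> d))"
      using cd x by (intro sweedler_cong) (simp_all add: m_assoc antipode_closed antipode_mult)
    also have "\<dots> = S c \<star> (adj x y \<star> d)"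
      unfolding adj_def by (rule sweedler_natural[of "\<lambda>z. S c \<star> (z \<star> d)", symmetric]; intro linearity x y cd)
    finally show "sweedler y (\<lambda>a b. S (a \<star> c) \<star> (x \<star> (b \<star> d))) = S c \<star> (adj x y \<star> d)" .
  qed
  finally show ?thesis by (simp add: adj_def[of "adj x y"])
qed

text \<open>\<open>z\<^sub>1 S(z\<^sub>2) y z\<^sub>3 = y z\<close>: moving \<open>z\<close> past \<open>y\<close> by conjugation.\<close>

lemma sweedler_mult_adj:
  assumes y: "y \<in> carrier H" and z: "z \<in> carrier H"
  shows "sweedler z (\<lambda>c d. c \<star> adj y d) = y \<star> z"
proof -
  have "sweedler z (\<lambda>c d. c \<star> adj y d) = sweedler z (\<lambda>c p. sweedler p (\<lambda>a b. c \<star> S a \<star> (y \<star> b)))"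
  proof (rule sweedler_cong[OF refl])
    fix c p assume cp: "c \<in> carrier H" "p \<in> carrier H"
    have "c \<star> adj y p = sweedler p (\<lambda>a b. c \<star> (S a \<star> (y \<star> b)))"
      unfolding adj_def by (rule sweedler_natural[of "\<lambda>z. c \<star> z"]; intro linearity y cp)
    also have "\<dots> = sweedler p (\<lambda>a b. c \<star> S a \<star> (y \<star> b))"
      using cp y by (intro sweedler_cong) (simp_all add: m_assoc antipode_closed)
    finally show "c \<star> adj y p = sweedler p (\<lambda>a b. c \<star> S a \<star> (y \<star> b))" .
  qed
  also have "\<dots> = sweedler z (\<lambda>p b. sweedler p (\<lambda>c a. c \<star> S a \<star> (y \<star> b)))"
    by (rule sweedler_coassoc[OF z, symmetric]; intro linearity y)
  also have "\<dots> = sweedler z (\<lambda>p b. y \<star> (\<epsilon> p \<odot>\<^bsub>H\<^esub> b))"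
  proof (rule sweedler_cong[OF refl])
    fix p b assume pb: "p \<in> carrier H" "b \<in> carrier H"
    have "sweedler p (\<lambda>c a. c \<star> S a \<star> (y \<star> b)) = sweedler p (\<lambda>c a. c \<star> S a) \<star> (y \<star> b)"
      by (rule sweedler_natural[of "\<lambda>z. z \<star> (y \<star> b)", symmetric]; intro linearity y pb)
    also have "\<dots> = y \<star> (\<epsilon> p \<odot>\<^bsub>H\<^esub> b)"
      using pb y by (simp add: sweedler_antipode_right smult_mult_left smult_mult_right counit_closed)
    finally show "sweedler p (\<lambda>c a. c \<star> S a \<star> (y \<star> b)) = y \<star> (\<epsilon> p \<odot>\<^bsub>H\<^esub> b)" .
  qed
  also have "\<dots> = y \<star> sweedler z (\<lambda>p b. \<epsilon> p \<odot>\<^bsub>H\<^esub> b)"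
    by (rule sweedler_natural[of "\<lambda>x. y \<star> x", symmetric]; intro linearity y z)
  also have "\<dots> = y \<star> z" by (simp add: sweedler_counit_left[OF z])
  finally show ?thesis .
qed

text \<open>Write \<open>x \<triangleleft> y\<close> for \<open>adj x y\<close>. Since \<open>\<triangleleft>\<close> is an action,
  \<open>(x \<triangleleft> z\<^sub>1) \<triangleleft> (y \<triangleleft> z\<^sub>2) = x \<triangleleft> (z\<^sub>1 (y \<triangleleft> z\<^sub>2)) = x \<triangleleft> (y z) = (x \<triangleleft> y) \<triangleleft> z\<close>.\<close>

lemma adj_self_distributive:
  assumes x: "x \<in> carrier H" and y: "y \<in> carrier H" and z: "z \<in> carrier H"
  shows "sweedler z (\<lambda>c d. adj (adj x c) (adj y d)) = adj (adj x y) z"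
proof -
  have "sweedler z (\<lambda>c d. adj (adj x c) (adj y d)) = sweedler z (\<lambda>c d. adj x (c \<star> adj y d))"
    using x y by (intro sweedler_cong) (simp_all add: adj_mult adj_closed)
  also have "\<dots> = adj x (sweedler z (\<lambda>c d. c \<star> adj y d))"
    by (rule sweedler_natural[of "adj x", symmetric]; intro linearity lin_adj x y z adj_closed)
  also have "\<dots> = adj (adj x y) z"
    by (simp add: sweedler_mult_adj adj_mult x y z)
  finally show ?thesis .
qed

lemma adjoint_map_linear: "adjoint_map K H \<Delta> S \<in> linear_maps K HH H"
  and adjoint_map_pure: "\<lbrakk>x \<in> carrier H; y \<in> carrier H\<rbrakk> \<Longrightarrow> adjoint_map K H \<Delta> S (x \<otimes>\<^sub>t y) = adj x y"
proof -
  note M = module_H and MM = module_HH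
  \<comment> \<open>Everything after \<open>1 \<otimes> \<Delta>\<close>, so that \<open>r\<close> sends \<open>x \<otimes> (a \<otimes> b)\<close> to \<open>S(a) x b\<close>.\<close>
  define r where "r = mult_map K H \<circ> tensor_map K H HH H H id (mult_map K H) \<circ> tensor_map K H HH H HH S id \<circ>
    tensor_assoc K H H H \<circ> tensor_map K HH H HH H (tensor_flip K H H) id \<circ> tensor_assoc_inv K H H H"
  have r: "r \<in> linear_maps K (tensor_product K H HH) H"
    unfolding r_def
    by (rule linear_maps_comp[OF tensor_assoc_inv_linear[OF M M M]
          linear_maps_comp[OF tensor_map_linear[OF MM M MM M tensor_flip_linear[OF M M] linear_maps_id]
          linear_maps_comp[OF tensor_assoc_linear[OF M M M]
          linear_maps_comp[OF tensor_map_linear[OF M MM M MM antipode_linear linear_maps_id]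
          linear_maps_comp[OF tensor_map_linear[OF M MM M M linear_maps_id mult_map_linear]
          mult_map_linear]]]]])
  have r_pure: "r (pure_tensor K H HH x (a \<otimes>\<^sub>t b)) = S a \<star> (x \<star> b)"
    if "x \<in> carrier H" "a \<in> carrier H" "b \<in> carrier H" for x a b
    unfolding r_def using that
    by (simp add: tensor_assoc_inv_pure[OF M M M] tensor_assoc_pure[OF M M M] tensor_flip_pure[OF M M]
        tensor_map_pure[OF MM M MM M tensor_flip_linear[OF M M] linear_maps_id]
        tensor_map_pure[OF M MM M MM antipode_linear linear_maps_id]
        tensor_map_pure[OF M MM M M linear_maps_id mult_map_linear]
        pure_tensor_closed[OF M M] mult_map_pure antipode_closed)
  note right = tensor_map_linear[OF M M M MM linear_maps_id comult_linear]
  have def: "adjoint_map K H \<Delta> S = r \<circ> tensor_map K H H H HH id \<Delta>"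
    by (simp add: adjoint_map_def Let_def r_def)
  show "adjoint_map K H \<Delta> S \<in> linear_maps K HH H"
    unfolding def by (rule linear_maps_comp[OF right r])
  assume x: "x \<in> carrier H" and y: "y \<in> carrier H"
  have "adjoint_map K H \<Delta> S (x \<otimes>\<^sub>t y) = r (pure_tensor K H HH x (\<Delta> y))"
    using x y by (simp add: def tensor_map_pure[OF M M M MM linear_maps_id comult_linear])
  also have "\<dots> = sweedler y (\<lambda>a b. r (pure_tensor K H HH x (a \<otimes>\<^sub>t b)))"
    by (rule linear_map_comult[OF linear_maps_compose[OF r
            bilinear_maps_right[OF pure_tensor_bilinear[OF M MM] x]] y])
  also have "\<dots> = adj x y"
    unfolding adj_def using x by (intro sweedler_cong) (simp_all add: r_pure)
  finally show "adjoint_map K H \<Delta> S (x \<otimes>\<^sub>t y) = adj x y" .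
qed

text \<open>Uniqueness in the universal property, applied to the outer tensor product and then to the inner one.\<close>

lemma linear_maps_eq_on_triple_tensors:
  assumes f: "f \<in> linear_maps K (tensor_product K HH H) H" and g: "g \<in> linear_maps K (tensor_product K HH H) H"
    and eq: "\<And>x y z. \<lbrakk>x \<in> carrier H; y \<in> carrier H; z \<in> carrier H\<rbrakk> \<Longrightarrow>
      f (pure_tensor K HH H (x \<otimes>\<^sub>t y) z) = g (pure_tensor K HH H (x \<otimes>\<^sub>t y) z)"
    and t: "t \<in> carrier (tensor_product K HH H)"
  shows "f t = g t"
proof (rule tensor_product_ext[OF module_HH module_H module_H f g _ t])
  fix s z assume s: "s \<in> carrier HH" and z: "z \<in> carrier H"
  note left = bilinear_maps_left[OF pure_tensor_bilinear[OF module_HH module_H] z]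
  show "f (pure_tensor K HH H s z) = g (pure_tensor K HH H s z)"
    by (rule tensor_product_ext[OF module_H module_H module_H linear_maps_compose[OF f left]
          linear_maps_compose[OF g left] eq[OF _ _ z] s])
qed

text \<open>Both composites are linear, so it suffices to compare them at \<open>(x \<otimes> y) \<otimes> z\<close>, where
  they become the two sides of the elementwise identity.\<close>

lemma adjoint_map_self_distributive:
  fixes q
  defines "q \<equiv> adjoint_map K H \<Delta> S"
  assumes t: "t \<in> carrier (tensor_product K HH H)"
  shows "(q \<circ> tensor_map K HH H H H q id) t =
    (q \<circ> tensor_map K HH HH H H q q \<circ> middle_flip K H \<circ> tensor_map K HH H HH HH id \<Delta>) t"
proof -
  note M = module_H and MM = module_HH
  note q = adjoint_map_linear[folded q_def] and q_pure = adjoint_map_pure[folded q_def]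
  note L = tensor_map_linear[OF MM M M M q linear_maps_id]
    and L_pure = tensor_map_pure[OF MM M M M q linear_maps_id]
  note R = tensor_map_linear[OF MM M MM MM linear_maps_id comult_linear]
    and R_pure = tensor_map_pure[OF MM M MM MM linear_maps_id comult_linear]
  define r where "r = q \<circ> tensor_map K HH HH H H q q \<circ> middle_flip K H"
  have r: "r \<in> linear_maps K (tensor_product K HH HH) H"
    unfolding r_def
    by (rule linear_maps_comp[OF middle_flip_linear[OF M] linear_maps_comp[OF tensor_map_linear[OF MM MM M M q q] q]])
  have r_pure: "r (pure_tensor K HH HH (x \<otimes>\<^sub>t y) (c \<otimes>\<^sub>t d)) = adj (adj x c) (adj y d)"
    if "x \<in> carrier H" "y \<in> carrier H" "c \<in> carrier H" "d \<in> carrier H" for x y c d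
    unfolding r_def using that
    by (simp add: middle_flip_pure[OF M] tensor_map_pure[OF MM MM M M q q] q_pure adj_closed pure_tensor_closed[OF M M])
  show ?thesis
    unfolding r_def[symmetric]
  proof (rule linear_maps_eq_on_triple_tensors[OF linear_maps_comp[OF L q] linear_maps_comp[OF R r] _ t])
    fix x y z assume x: "x \<in> carrier H" and y: "y \<in> carrier H" and z: "z \<in> carrier H"
    note xy = pure_tensor_closed[OF M M x y]
    have "r (pure_tensor K HH HH (x \<otimes>\<^sub>t y) (\<Delta> z)) = sweedler z (\<lambda>c d. r (pure_tensor K HH HH (x \<otimes>\<^sub>t y) (c \<otimes>\<^sub>t d)))"
      by (rule linear_map_comult[OF linear_maps_compose[OF r
              bilinear_maps_right[OF pure_tensor_bilinear[OF MM MM] xy]] z])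
    also have "\<dots> = sweedler z (\<lambda>c d. adj (adj x c) (adj y d))"
      using x y by (intro sweedler_cong) (simp_all add: r_pure)
    also have "\<dots> = adj (adj x y) z"
      by (rule adj_self_distributive[OF x y z])
    finally show "(q \<circ> tensor_map K HH H H H q id) (pure_tensor K HH H (x \<otimes>\<^sub>t y) z) =
        (r \<circ> tensor_map K HH H HH HH id \<Delta>) (pure_tensor K HH H (x \<otimes>\<^sub>t y) z)"
      using x y z xy by (simp add: L_pure R_pure q_pure adj_closed)
  qed
qed

end

theorem proposition3p6:
  fixes K :: "('k, 'm) ring_scheme" and H :: "('k, 'h, 'p) module_scheme"
    and \<Delta> :: "'h \<Rightarrow> ('h \<times> 'h \<Rightarrow> 'k) set" and \<epsilon> :: "'h \<Rightarrow> 'k" and S :: "'h \<Rightarrow> 'h"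
  defines "HH \<equiv> tensor_product K H H"
    and "q \<equiv> adjoint_map K H \<Delta> S"
  assumes "hopf_algebra K H \<Delta> \<epsilon> S"
  shows "\<forall>t \<in> carrier (tensor_product K HH H).
    (q \<circ> tensor_map K HH H H H q id) t =
    (q \<circ> tensor_map K HH HH H H q q \<circ> middle_flip K H \<circ> tensor_map K HH H HH HH id \<Delta>) t"
  unfolding HH_def q_def
  using hopf_algebra.adjoint_map_self_distributive[OF assms(3)] by blast

end
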